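(* Let $n\geq2$, $\mu\geq0$ and $s\in V^+$. Then every function holomorphic in $\widetilde{V_\mu^+}\cup\widetilde{D_{0,s}'}\cup T^+\cup T^-\subset\mathbb{C}^n$ can be holomorphically extended to the set $R$ of spacelike points; i.e. $R\subset H\big(\widetilde{V_\mu^+}\cup\widetilde{D_{0,s}'}\cup T^+\cup T^-\big)$.
   Context: Minkowski product on $\mathbb{R}^n$ (and bilinearly on $\mathbb{C}^n$): $ab=a_0b_0-a_1b_1-\dots-a_{n-1}b_{n-1}$. $V^+=\{x: x^2>0,x_0>0\}$, $V^-=-V^+$, $V_\mu^+=\{x: x^2>\mu^2,x_0>0\}$, $T^\pm=\mathbb{R}^n+iV^\pm$. For $y\in x+V^+$, $D_{x,y}=(x+V^+)\cap(y+V^-)$. For $S\subset\mathbb{R}^n$, $S'=\{x: (x-y)^2<0\ \forall y\in S\}$, and $R=\{0\}'=\{x: x^2<0\}$. For open $B\subset\mathbb{R}^n$, $\widetilde B:=\bigcup_{x\in B}\{z\in\mathbb{C}^n:\|z-x\|<\frac1{32}\operatorname{dist}(x,\partial B)\}$. $H(\cdot)$ denotes the envelope of holomorphy. *)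

theory Defs
  imports "HOL-Analysis.Analysis"
begin

text \<open>Points of R^n are pairs (time component, spatial part in R^('m)), so n = 1 + CARD('m) \<ge> 2.
  Points of C^n are pairs (complex, complex^('m)). Both carry the Euclidean (product) norm.\<close>

type_synonym 'm rpt = "real \<times> (real^'m)"
type_synonym 'm cpt = "complex \<times> (complex^'m)"

definition mink :: "'m::finite rpt \<Rightarrow> 'm rpt \<Rightarrow> real" where
  "mink a b = fst a * fst b - (\<Sum>i\<in>UNIV. snd a $ i * snd b $ i)"

definition msq :: "'m::finite rpt \<Rightarrow> real" where
  "msq a = mink a a"

definition Vplus :: "'m::finite rpt set" where
  "Vplus = {x. msq x > 0 \<and> fst x > 0}"

definition Vminus :: "'m::finite rpt set" where
  "Vminus = uminus ` Vplus"

definition Vmu :: "real \<Rightarrow> 'm::finite rpt set" where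
  "Vmu \<mu> = {x. msq x > \<mu>^2 \<and> fst x > 0}"

definition cpx :: "'m::finite rpt \<Rightarrow> 'm cpt" where
  "cpx x = (complex_of_real (fst x), \<chi> i. complex_of_real (snd x $ i))"

definition im_pt :: "'m::finite cpt \<Rightarrow> 'm rpt" where
  "im_pt z = (Im (fst z), \<chi> i. Im (snd z $ i))"

definition Tplus :: "'m::finite cpt set" where
  "Tplus = {z. im_pt z \<in> Vplus}"

definition Tminus :: "'m::finite cpt set" where
  "Tminus = {z. im_pt z \<in> Vminus}"

definition Dcone :: "'m::finite rpt \<Rightarrow> 'm rpt \<Rightarrow> 'm rpt set" where
  "Dcone x y = ((\<lambda>v. x + v) ` Vplus) \<inter> ((\<lambda>v. y + v) ` Vminus)"

definition ccompl :: "'m::finite rpt set \<Rightarrow> 'm rpt set" where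
  "ccompl S = {x. \<forall>y\<in>S. msq (x - y) < 0}"

definition Rspace :: "'m::finite rpt set" where
  "Rspace = ccompl {0}"

definition tilde :: "'m::finite rpt set \<Rightarrow> 'm cpt set" where
  "tilde B = (\<Union>x\<in>B. {z. norm (z - cpx x) < infdist x (frontier B) / 32})"

definition cscale :: "complex \<Rightarrow> 'm::finite cpt \<Rightarrow> 'm cpt" where
  "cscale c z = (c * fst z, \<chi> i. c * snd z $ i)"

definition holo_on :: "('m::finite cpt \<Rightarrow> complex) \<Rightarrow> 'm cpt set \<Rightarrow> bool" where
  "holo_on f U \<longleftrightarrow> (\<forall>z\<in>U. \<exists>f'. (f has_derivative f') (at z) \<and>
       (\<forall>v. f' (cscale \<i> v) = \<i> * f' v))"

end

theory Submission
  imports Defs "HOL-Complex_Analysis.Complex_Analysis"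
begin

text \<open>
  A spacelike point is written as \<open>q - p\<close> with \<open>p\<close>, \<open>q\<close> null and future directed; put \<open>m = pq\<close>. In the plane
  of the points \<open>u p + v q\<close> the tube \<open>T\<^sup>+\<close> contains \<open>Im u, Im v > 0\<close>, the set \<open>V\<^sub>\<mu>\<^sup>+\<close> contains \<open>u, v > 0\<close> with
  \<open>2 m u v > \<mu>\<^sup>2\<close>, and the interior of \<open>D\<^sub>0\<^sub>,\<^sub>s'\<close> contains \<open>u < 0\<close>, \<open>v > B\<close> for some \<open>B\<close>. One moves a disc, with its boundary
  kept inside the domain, from a position inside the domain to one through \<open>(u, v) = (- 1, 1)\<close>. The disc is the
  image of the rectangle \<open>|Re \<xi>| \<le> L\<close>, \<open>|Im \<xi>| \<le> \<pi>\<close>, on which \<open>u = A - const * exp \<xi>\<close> covers a slit annulus, cut along a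
  positive half-line on which only \<open>V\<^sub>\<mu>\<^sup>+\<close> is available; \<open>v\<close> is the sum of \<open>- 1 / (2 u)\<close> and a cubic polynomial in \<open>\<xi>\<close> with
  small slope \<open>\<kappa>\<close>. Over the long interval \<open>|Re \<xi>| \<le> L\<close> the cubic climbs from about \<open>1 / 2\<close> to more than \<open>B\<close>, but its
  imaginary part on the cut is \<open>O(\<kappa>)\<close>, and it decreases near both ends, which puts the end circles into \<open>T\<^sup>\<plusminus>\<close>.
  Cauchy's integral over the boundary of the rectangle then gives the extension near the spacelike point.
\<close>

section \<open>Holomorphic functions of several variables\<close>

lemma cscale_scaleR: "cscale (of_real r) v = r *\<^sub>R v"
  by (simp add: cscale_def prod_eq_iff vec_eq_iff) (simp add: scaleR_conv_of_real)

lemma cscale_0 [simp]: "cscale 0 v = 0" and cscale_1 [simp]: "cscale 1 v = v"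
  using cscale_scaleR[of 0 v] cscale_scaleR[of 1 v] by simp_all

lemma cscale_add_left: "cscale (a + b) v = cscale a v + cscale b v"
  by (simp add: cscale_def prod_eq_iff vec_eq_iff algebra_simps)

lemma cscale_add_right: "cscale a (v + w) = cscale a v + cscale a w"
  by (simp add: cscale_def prod_eq_iff vec_eq_iff algebra_simps)

lemma cscale_cscale: "cscale a (cscale b v) = cscale (a * b) v"
  by (simp add: cscale_def prod_eq_iff vec_eq_iff algebra_simps)

lemma norm_cscale: "norm (cscale a v) = norm a * norm v"
proof -
  have "norm (\<chi> i. a * snd v $ i) = norm a * norm (snd v)"
    by (simp add: norm_vec_def L2_set_def norm_mult power_mult_distrib
        real_sqrt_mult flip: sum_distrib_left)
  then show ?thesis
    by (simp add: norm_prod_def cscale_def norm_mult power_mult_distrib real_sqrt_mult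
        flip: distrib_left)
qed

lemma bounded_linear_cscale_left: "bounded_linear (\<lambda>a. cscale a v)"
proof (rule bounded_linear_intro[where K = "norm v"])
  show "cscale (r *\<^sub>R a) v = r *\<^sub>R cscale a v" for r a
    by (simp add: cscale_cscale scaleR_conv_of_real flip: cscale_scaleR)
qed (simp_all add: cscale_add_left norm_cscale)

lemma has_derivative_cscale:
  assumes "(a has_field_derivative a') (at t)"
  shows "((\<lambda>t. cscale (a t) v) has_derivative (\<lambda>h. cscale h (cscale a' v))) (at t)"
  using bounded_linear.has_derivative[OF bounded_linear_cscale_left
      assms[unfolded has_field_derivative_def], of v]
  by (simp add: cscale_cscale mult.commute)

text \<open>\<open>holo_on\<close> asks only that a real derivative commutes with multiplication by
  \<open>\<i>\<close>; splitting the scalar into real and imaginary part turns this into complex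
  linearity.\<close>

lemma clinear_cscale:
  assumes "bounded_linear D" "\<forall>v. D (cscale \<i> v) = \<i> * D v"
  shows "D (cscale c v) = c * D v"
proof -
  interpret bounded_linear D by fact
  have "cscale c v = cscale (of_real (Re c)) v + cscale (of_real (Im c)) (cscale \<i> v)"
    by (simp add: cscale_cscale flip: cscale_add_left) (metis complex_eq mult.commute)
  then have "cscale c v = Re c *\<^sub>R v + Im c *\<^sub>R cscale \<i> v"
    by (simp only: cscale_scaleR)
  then have "D (cscale c v) = Re c *\<^sub>R D v + Im c *\<^sub>R (\<i> * D v)"
    using assms(2) by (metis add scaleR)
  also have "\<dots> = (of_real (Re c) + \<i> * of_real (Im c)) * D v"
    by (simp add: scaleR_conv_of_real algebra_simps)
  finally show ?thesis by (simp add: complex_eq[symmetric])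
qed

lemma holo_on_subset: "holo_on f U \<Longrightarrow> V \<subseteq> U \<Longrightarrow> holo_on f V"
  by (auto simp: holo_on_def)

lemma holo_on_imp_continuous_on: "holo_on f U \<Longrightarrow> continuous_on U f"
  unfolding holo_on_def
  by (meson continuous_at_imp_continuous_on has_derivative_continuous)

lemma holo_on_add: "holo_on f U \<Longrightarrow> holo_on g U \<Longrightarrow> holo_on (\<lambda>z. f z + g z) U"
  unfolding holo_on_def
proof
  fix z assume *: "\<forall>z\<in>U. \<exists>f'. (f has_derivative f') (at z) \<and> (\<forall>v. f' (cscale \<i> v) = \<i> * f' v)"
    "\<forall>z\<in>U. \<exists>f'. (g has_derivative f') (at z) \<and> (\<forall>v. f' (cscale \<i> v) = \<i> * f' v)" "z \<in> U"
  then obtain f' g' where "(f has_derivative f') (at z)" "\<forall>v. f' (cscale \<i> v) = \<i> * f' v"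
    "(g has_derivative g') (at z)" "\<forall>v. g' (cscale \<i> v) = \<i> * g' v" by blast
  then show "\<exists>f'. ((\<lambda>z. f z + g z) has_derivative f') (at z) \<and> (\<forall>v. f' (cscale \<i> v) = \<i> * f' v)"
    by (intro exI[of _ "\<lambda>v. f' v + g' v"]) (auto simp: algebra_simps intro: has_derivative_add)
qed

lemma holo_on_cmult:
  assumes "holo_on f U" shows "holo_on (\<lambda>z. c * f z) U"
  unfolding holo_on_def
proof
  fix z assume "z \<in> U"
  with assms obtain f' where "(f has_derivative f') (at z)" "\<forall>v. f' (cscale \<i> v) = \<i> * f' v"
    unfolding holo_on_def by blast
  then show "\<exists>f'. ((\<lambda>z. c * f z) has_derivative f') (at z) \<and> (\<forall>v. f' (cscale \<i> v) = \<i> * f' v)"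
    by (intro exI[of _ "\<lambda>v. c * f' v"]) (auto simp: algebra_simps intro: has_derivative_mult_right)
qed

lemma holo_on_cong:
  assumes "open U" "\<And>z. z \<in> U \<Longrightarrow> f z = g z" "holo_on f U"
  shows "holo_on g U"
  unfolding holo_on_def
proof
  fix z assume "z \<in> U"
  then obtain f' where "(f has_derivative f') (at z)" "\<forall>v. f' (cscale \<i> v) = \<i> * f' v"
    using assms(3) unfolding holo_on_def by blast
  then show "\<exists>f'. (g has_derivative f') (at z) \<and> (\<forall>v. f' (cscale \<i> v) = \<i> * f' v)"
    using has_derivative_transform_within_open[where f = f and g = g, OF _ \<open>open U\<close> \<open>z \<in> U\<close> assms(2)]
    by blast
qed

lemma holo_on_translate:
  assumes "holo_on f U"
  shows "holo_on (\<lambda>z. f (z + c)) {z. z + c \<in> U}"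
  unfolding holo_on_def
proof
  fix z assume "z \<in> {z. z + c \<in> U}"
  with assms obtain f' where *: "(f has_derivative f') (at (z + c))" "\<forall>v. f' (cscale \<i> v) = \<i> * f' v"
    unfolding holo_on_def by blast
  have "((\<lambda>z. f (z + c)) has_derivative (\<lambda>h. f' h)) (at z)"
    by (rule has_derivative_compose[where f = "\<lambda>z. z + c" and f' = "\<lambda>h. h" and g = f, OF _ *(1)])
      (auto intro!: derivative_eq_intros)
  with * show "\<exists>f'. ((\<lambda>z. f (z + c)) has_derivative f') (at z) \<and> (\<forall>v. f' (cscale \<i> v) = \<i> * f' v)"
    by blast
qed

lemma holo_on_has_field_derivative:
  assumes "(f has_derivative D) (at (c t))" "\<forall>v. D (cscale \<i> v) = \<i> * D v"
    and "(c has_derivative (\<lambda>h. cscale h w)) (at t)"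
  shows "((\<lambda>t. f (c t)) has_field_derivative D w) (at t)"
proof -
  have "((\<lambda>t. f (c t)) has_derivative (\<lambda>h. D (cscale h w))) (at t)"
    by (rule has_derivative_compose[OF assms(3,1)])
  moreover have "D (cscale h w) = D w * h" for h
    using clinear_cscale[OF has_derivative_bounded_linear[OF assms(1)] assms(2)] by simp
  ultimately show ?thesis by (simp add: has_field_derivative_def)
qed

text \<open>Complex differentiability of a curve into C^n: the derivative is \<open>h\<close> times
  a fixed vector. Along such curves a function that is \<open>holo_on\<close> becomes holomorphic in
  one variable.\<close>

definition holo_curve_at :: "(complex \<Rightarrow> 'm::finite cpt) \<Rightarrow> complex \<Rightarrow> bool" where
  "holo_curve_at c t \<longleftrightarrow> (\<exists>w. (c has_derivative (\<lambda>h. cscale h w)) (at t))"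

lemma holo_curve_at_add_const: "holo_curve_at c t \<Longrightarrow> holo_curve_at (\<lambda>t. c t + z) t"
  unfolding holo_curve_at_def using has_derivative_add_const by blast

lemma holo_curve_at_cscale:
  assumes "(a has_field_derivative a') (at t)"
  shows "holo_curve_at (\<lambda>t. cscale (a t) v) t"
  unfolding holo_curve_at_def using has_derivative_cscale[OF assms] by blast

lemma holo_curve_at_add:
  assumes "holo_curve_at c t" "holo_curve_at d t"
  shows "holo_curve_at (\<lambda>t. c t + d t) t"
proof -
  obtain v w where "(c has_derivative (\<lambda>h. cscale h v)) (at t)" "(d has_derivative (\<lambda>h. cscale h w)) (at t)"
    using assms unfolding holo_curve_at_def by blast
  then have "((\<lambda>t. c t + d t) has_derivative (\<lambda>h. cscale h v + cscale h w)) (at t)"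
    by (rule has_derivative_add)
  then show ?thesis unfolding holo_curve_at_def cscale_add_right[symmetric] by blast
qed

lemma holomorphic_on_holo_on_curve:
  assumes "holo_on f U" "open S" "\<And>t. t \<in> S \<Longrightarrow> c t \<in> U"
    and "\<And>t. t \<in> S \<Longrightarrow> holo_curve_at c t"
  shows "(\<lambda>t. f (c t)) holomorphic_on S"
  unfolding holomorphic_on_open[OF \<open>open S\<close>]
proof
  fix t assume "t \<in> S"
  then obtain D where "(f has_derivative D) (at (c t))" "\<forall>v. D (cscale \<i> v) = \<i> * D v"
    using assms(1,3) unfolding holo_on_def by blast
  moreover obtain w where "(c has_derivative (\<lambda>h. cscale h w)) (at t)"
    using assms(4) \<open>t \<in> S\<close> unfolding holo_curve_at_def by blast
  ultimately show "\<exists>f'. ((\<lambda>t. f (c t)) has_field_derivative f') (at t)"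
    using holo_on_has_field_derivative by blast
qed

lemma has_derivative_cscale_line:
  "((\<lambda>t. cscale t v + z) has_derivative (\<lambda>h. cscale h v)) (at t)"
proof -
  have "((\<lambda>t. cscale t v) has_derivative (\<lambda>h. cscale h v)) (at t)"
    by (rule bounded_linear_imp_has_derivative[OF bounded_linear_cscale_left])
  then show ?thesis by (auto intro!: derivative_eq_intros)
qed

lemma holomorphic_on_holo_on_line:
  assumes "holo_on f U" "open S" "\<And>t. t \<in> S \<Longrightarrow> cscale t v + z \<in> U"
  shows "(\<lambda>t. f (cscale t v + z)) holomorphic_on S"
  by (rule holomorphic_on_holo_on_curve[OF assms]) (use has_derivative_cscale_line holo_curve_at_def in blast)+

text \<open>The identity theorem is reduced to one variable on the complex line joining a point of
  \<open>B\<close> to \<open>z\<close>: the preimage of the convex set \<open>A\<close> is convex,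
  hence connected, and that of \<open>B\<close> is open and nonempty.\<close>

lemma holo_on_convex_eq:
  assumes "holo_on f A" "holo_on g A" "open A" "convex A" "open B" "B \<subseteq> A" "B \<noteq> {}"
    and eq: "\<And>z. z \<in> B \<Longrightarrow> f z = g z" and "z \<in> A"
  shows "f z = g z"
proof -
  obtain p where "p \<in> B" using assms by blast
  define l where "l t = cscale t (z - p) + p" for t
  have cont: "continuous_on UNIV l"
    unfolding l_def
    by (intro continuous_intros linear_continuous_on bounded_linear_cscale_left)
  have l: "l t = t *\<^sub>R z + (1 - t) *\<^sub>R p" for t :: real
    by (simp add: l_def cscale_scaleR algebra_simps)
  interpret c: bounded_linear "\<lambda>t. cscale t (z - p)" by (rule bounded_linear_cscale_left)
  have l2: "l ((1 - r) *\<^sub>R s + r *\<^sub>R t) = (1 - r) *\<^sub>R l s + r *\<^sub>R l t" for r s t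
    by (simp only: l_def c.add c.scaleR) (simp add: algebra_simps)
  have conv: "convex (l -` A)"
    unfolding convex_alt using \<open>convex A\<close> l2 by (auto simp: convex_alt)
  have "f (l 1) = g (l 1)"
  proof (rule analytic_continuation_open[where f = "\<lambda>t. f (l t)" and g = "\<lambda>t. g (l t)" and s = "l -` B" and s' = "l -` A"])
    show "open (l -` B)" "open (l -` A)"
      using cont assms by (auto intro: open_vimage)
    show "l -` B \<noteq> {}" using l[of 0] \<open>p \<in> B\<close> by (metis empty_iff diff_zero of_real_0 scaleR_one scaleR_zero_left add_0 vimage_eq)
    show "connected (l -` A)" using conv by (rule convex_connected)
    have "open (l -` A)" using cont \<open>open A\<close> by (rule open_vimage[rotated])
    then show "(\<lambda>t. f (l t)) holomorphic_on l -` A" "(\<lambda>t. g (l t)) holomorphic_on l -` A"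
      unfolding l_def using assms(1,2)
      by (auto intro!: holomorphic_on_holo_on_line[where U = A])
    show "1 \<in> l -` A" using l[of 1] \<open>z \<in> A\<close> by simp
  qed (use assms in auto)
  then show ?thesis using l[of 1] by simp
qed

section \<open>Holomorphic dependence on parameters\<close>

text \<open>Taylor's formula with the second derivative bounded by Cauchy's inequality on discs of
  radius \<open>r / 3\<close>. These stay inside \<open>ball 0 r\<close> because their centres have
  norm below \<open>r / 2\<close>; the constant 18 is \<open>2 * 3 ^ 2\<close>.\<close>

lemma holomorphic_Taylor_bound:
  assumes "h holomorphic_on ball 0 r" "0 < r" and M: "\<And>t. t \<in> ball 0 r \<Longrightarrow> norm (h t) \<le> M"
    and "norm t < r / 2"
  shows "norm (h t - h 0 - deriv h 0 * t) \<le> 18 * M * norm t ^ 2 / r ^ 2"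
proof -
  have "norm ((deriv ^^ 0) h t - (\<Sum>i\<le>1. (deriv ^^ i) h 0 * (t - 0) ^ i / fact i))
      \<le> (2 * M / (r / 3) ^ 2) * norm (t - 0) ^ Suc 1 / fact 1"
  proof (rule complex_Taylor[where S = "ball 0 (r / 2)" and f = "\<lambda>i. (deriv ^^ i) h"])
    fix i x assume "x \<in> ball (0::complex) (r / 2)" "i \<le> (1::nat)"
    then show "((deriv ^^ i) h has_field_derivative (deriv ^^ Suc i) h x) (at x within ball 0 (r / 2))"
      using holomorphic_derivI[OF holomorphic_higher_deriv[OF assms(1), of i], of x] assms(2)
      by (auto intro: DERIV_subset)
  next
    fix x :: complex assume x: "x \<in> ball 0 (r / 2)"
    have sub: "cball x (r / 3) \<subseteq> ball 0 r"
    proof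
      fix y assume "y \<in> cball x (r / 3)"
      then show "y \<in> ball 0 r"
        using x norm_triangle_ineq[of x "y - x"] assms(2) by (simp add: dist_norm norm_minus_commute)
    qed
    have "norm ((deriv ^^ 2) h x) \<le> fact 2 * M / (r / 3) ^ 2"
    proof (rule Cauchy_inequality)
      show "h holomorphic_on ball x (r / 3)"
        using sub assms(1) by (meson ball_subset_cball holomorphic_on_subset order_trans)
      show "continuous_on (cball x (r / 3)) h"
        using sub assms(1) by (meson holomorphic_on_imp_continuous_on holomorphic_on_subset)
      show "norm (h y) \<le> M" if "norm (x - y) = r / 3" for y
        using sub that by (intro M) (auto simp: dist_norm)
    qed (use assms in simp)
    then show "norm ((deriv ^^ Suc 1) h x) \<le> 2 * M / (r / 3) ^ 2"
      by (simp add: numeral_2_eq_2)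
  qed (use assms in auto)
  moreover have "(2 * M / (r / 3) ^ 2) * norm (t - 0) ^ Suc 1 = 18 * M * norm t ^ 2 / r ^ 2"
    using assms(2) by (simp add: field_simps power2_eq_square)
  ultimately show ?thesis
    by (simp add: algebra_simps numeral_2_eq_2)
qed

text \<open>The remainder depends on \<open>f\<close> only through the bound \<open>M\<close>, so it
  is uniform over a bounded family; this permits differentiation under the integral sign. It is the
  one-variable estimate at parameter 1 on the complex line through \<open>z\<close> in direction
  \<open>w\<close>.\<close>

lemma holo_on_Taylor_bound:
  assumes "holo_on f (ball z R)" "0 < R" and M: "\<And>y. y \<in> ball z R \<Longrightarrow> norm (f y) \<le> M"
    and D: "(f has_derivative D) (at z)" "\<forall>v. D (cscale \<i> v) = \<i> * D v"
    and w: "norm w < R / 2"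
  shows "norm (f (z + w) - f z - D w) \<le> 18 * M * norm w ^ 2 / R ^ 2"
proof (cases "w = 0")
  case True
  then show ?thesis using D(1) by (simp add: has_derivative_bounded_linear linear_0 bounded_linear.linear)
next
  case False
  define r where "r = R / norm w"
  define h where "h t = f (cscale t w + z)" for t
  have in_ball: "cscale t w + z \<in> ball z R" if "t \<in> ball 0 r" for t
    using that False by (simp add: dist_norm norm_cscale r_def field_simps)
  have "norm (h 1 - h 0 - deriv h 0 * 1) \<le> 18 * M * norm (1::complex) ^ 2 / r ^ 2"
  proof (rule holomorphic_Taylor_bound)
    show "h holomorphic_on ball 0 r"
      unfolding h_def using in_ball by (intro holomorphic_on_holo_on_line[OF assms(1)]) auto
    show "norm (h t) \<le> M" if "t \<in> ball 0 r" for t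
      unfolding h_def using in_ball[OF that] by (rule M)
  qed (use False assms(2) w in \<open>auto simp: r_def field_simps\<close>)
  moreover have "(h has_field_derivative D w) (at 0)"
    unfolding h_def
    by (rule holo_on_has_field_derivative[OF _ _ has_derivative_cscale_line]) (use D in auto)
  then have "deriv h 0 = D w" by (rule DERIV_imp_deriv)
  ultimately show ?thesis
    using False by (simp add: h_def r_def add.commute power_divide)
qed

section \<open>Integrals over a segment that depend on a parameter\<close>

lemma continuous_on_linepath_integral:
  assumes "continuous_on (closed_segment a b \<times> S) (\<lambda>(x, y). F x y)"
  shows "continuous_on S (\<lambda>y. contour_integral (linepath a b) (\<lambda>x. F x y))"
proof -
  have "continuous_on (S \<times> cbox 0 1) (\<lambda>(y, t). F (linepath a b t) y * (b - a))"
  proof -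
    have "continuous_on (S \<times> cbox 0 1) (\<lambda>p. (\<lambda>(x, y). F x y) (linepath a b (snd p), fst p))"
    proof (rule continuous_on_compose2[OF assms])
      show "continuous_on (S \<times> cbox 0 1) (\<lambda>p. (linepath a b (snd p), fst p))"
        by (intro continuous_intros continuous_on_compose2[OF continuous_on_linepath[of UNIV a b]]) auto
      show "(\<lambda>p. (linepath a b (snd p), fst p)) ` (S \<times> cbox 0 1) \<subseteq> closed_segment a b \<times> S"
        by (auto intro!: linepath_in_path)
    qed
    then have "continuous_on (S \<times> cbox 0 1) (\<lambda>p. F (linepath a b (snd p)) (fst p) * (b - a))"
      by (intro continuous_intros) simp
    then show ?thesis by (simp add: case_prod_unfold)
  qed
  then have "continuous_on S (\<lambda>y. integral (cbox 0 1) (\<lambda>t. F (linepath a b t) y * (b - a)))"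
    by (rule integral_continuous_on_param)
  then show ?thesis
    by (simp add: contour_integral_integral)
qed

lemma continuous_on_param1:
  assumes "continuous_on (A \<times> S) (\<lambda>(x, y). F x y)" "y \<in> S"
  shows "continuous_on A (\<lambda>x. F x y)"
proof -
  have "continuous_on A (\<lambda>x. (\<lambda>(x, y). F x y) (x, y))"
    by (rule continuous_on_compose2[OF assms(1)]) (use assms(2) in \<open>auto intro!: continuous_intros\<close>)
  then show ?thesis by simp
qed

lemma continuous_on_param2:
  assumes "continuous_on (A \<times> S) (\<lambda>(x, y). F x y)" "x \<in> A"
  shows "continuous_on S (F x)"
proof -
  have "continuous_on S (\<lambda>y. (\<lambda>(x, y). F x y) (x, y))"
    by (rule continuous_on_compose2[OF assms(1)]) (use assms(2) in \<open>auto intro!: continuous_intros\<close>)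
  then show ?thesis by simp
qed

text \<open>By Morera's theorem: the integral over a triangle is exchanged with the one over the
  segment, and the inner triangle integrals vanish by Cauchy's theorem.\<close>

lemma linepath_integral_holomorphic:
  assumes cont: "continuous_on (closed_segment a b \<times> S) (\<lambda>(x, y). F x y)" and "open S"
    and hol: "\<And>x. x \<in> closed_segment a b \<Longrightarrow> F x holomorphic_on S"
  shows "(\<lambda>y. contour_integral (linepath a b) (\<lambda>x. F x y)) holomorphic_on S"
proof (rule analytic_imp_holomorphic, rule Morera_triangle[OF _ \<open>open S\<close>], safe)
  show "continuous_on S (\<lambda>y. contour_integral (linepath a b) (\<lambda>x. F x y))"
    by (rule continuous_on_linepath_integral[OF cont])
next
  fix p q r assume hull: "convex hull {p, q, r} \<subseteq> S"
  let ?T = "\<lambda>x. contour_integral (linepath p q) (F x) + contour_integral (linepath q r) (F x)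
    + contour_integral (linepath r p) (F x)"
  have seg: "closed_segment p q \<subseteq> S" "closed_segment q r \<subseteq> S" "closed_segment r p \<subseteq> S"
    unfolding segment_convex_hull
    by (rule subset_trans[OF hull_mono hull], force)+
  have sw: "contour_integral (linepath u v) (\<lambda>y. contour_integral (linepath a b) (\<lambda>x. F x y))
      = contour_integral (linepath a b) (\<lambda>x. contour_integral (linepath u v) (F x))"
    "(\<lambda>x. contour_integral (linepath u v) (F x)) contour_integrable_on linepath a b"
    if "closed_segment u v \<subseteq> S" for u v
  proof -
    have c: "continuous_on (closed_segment a b \<times> closed_segment u v) (\<lambda>(x, y). F x y)"
      using that by (intro continuous_on_subset[OF cont]) auto
    show "contour_integral (linepath u v) (\<lambda>y. contour_integral (linepath a b) (\<lambda>x. F x y))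
      = contour_integral (linepath a b) (\<lambda>x. contour_integral (linepath u v) (F x))"
      by (rule contour_integral_swap[symmetric]) (use c in auto)
    have "continuous_on (closed_segment u v \<times> closed_segment a b) (\<lambda>(y, x). F x y)"
      using continuous_on_compose2[OF c, of "closed_segment u v \<times> closed_segment a b" "\<lambda>p. (snd p, fst p)"]
      by (force simp: case_prod_unfold intro!: continuous_intros)
    then have "continuous_on (closed_segment a b) (\<lambda>x. contour_integral (linepath u v) (\<lambda>y. F x y))"
      by (rule continuous_on_linepath_integral)
    then show "(\<lambda>x. contour_integral (linepath u v) (F x)) contour_integrable_on linepath a b"
      by (rule contour_integrable_continuous_linepath)
  qed
  have "?T x = 0" if "x \<in> closed_segment a b" for x
  proof -
    have "F x holomorphic_on convex hull {p, q, r}"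
      using hol[OF that] hull by (rule holomorphic_on_subset)
    from Cauchy_theorem_triangle[OF this]
    have "contour_integral (linepath p q +++ linepath q r +++ linepath r p) (F x) = 0"
      by (rule contour_integral_unique)
    moreover have "F x contour_integrable_on linepath p q" "F x contour_integrable_on linepath q r"
      "F x contour_integrable_on linepath r p"
      using seg continuous_on_param2[OF cont that]
      by (auto intro!: contour_integrable_continuous_linepath intro: continuous_on_subset)
    ultimately show ?thesis by (simp add: algebra_simps)
  qed
  then have "contour_integral (linepath a b) ?T = contour_integral (linepath a b) (\<lambda>x. 0)"
    by (intro contour_integral_cong) auto
  then show "contour_integral (linepath p q) (\<lambda>y. contour_integral (linepath a b) (\<lambda>x. F x y)) +
       contour_integral (linepath q r) (\<lambda>y. contour_integral (linepath a b) (\<lambda>x. F x y)) +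
       contour_integral (linepath r p) (\<lambda>y. contour_integral (linepath a b) (\<lambda>x. F x y)) = 0"
    using sw[OF seg(1)] sw[OF seg(2)] sw[OF seg(3)]
    by (simp add: contour_integral_add contour_integrable_add)
qed

text \<open>The derivative is the integral of the derivatives \<open>D x\<close>; the error is
  controlled by the quadratic Taylor bound, which is uniform in \<open>x\<close> because the segment
  is compact.\<close>

lemma linepath_integral_holo:
  fixes F :: "complex \<Rightarrow> 'm::finite cpt \<Rightarrow> complex"
  assumes cont: "continuous_on (closed_segment a b \<times> S) (\<lambda>(x, y). F x y)" and "open S"
    and hol: "\<And>x. x \<in> closed_segment a b \<Longrightarrow> holo_on (F x) S"
  shows "holo_on (\<lambda>z. contour_integral (linepath a b) (\<lambda>x. F x z)) S"
  unfolding holo_on_def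
proof
  fix z assume "z \<in> S"
  let ?g = "closed_segment a b" and ?I = "contour_integral (linepath a b)"
  obtain R where R: "0 < R" "cball z R \<subseteq> S"
    using \<open>open S\<close> \<open>z \<in> S\<close> open_contains_cball by blast
  have "compact ((\<lambda>(x, y). F x y) ` (?g \<times> cball z R))"
    using R by (intro compact_continuous_image continuous_on_subset[OF cont] compact_Times) auto
  then obtain M where "0 < M" and M: "\<And>x y. x \<in> ?g \<Longrightarrow> y \<in> cball z R \<Longrightarrow> norm (F x y) \<le> M"
    using bounded_pos compact_imp_bounded by (metis (mono_tags, lifting) SigmaI case_prod_conv imageI)
  have "\<forall>x\<in>?g. \<exists>D. (F x has_derivative D) (at z) \<and> (\<forall>v. D (cscale \<i> v) = \<i> * D v)"
    using hol \<open>z \<in> S\<close> unfolding holo_on_def by blast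
  then obtain D where D: "\<And>x. x \<in> ?g \<Longrightarrow> (F x has_derivative D x) (at z)"
    "\<And>x. x \<in> ?g \<Longrightarrow> \<forall>v. D x (cscale \<i> v) = \<i> * D x v"
    by metis
  define C where "C = 18 * M / R ^ 2"
  have "0 < C" using \<open>0 < M\<close> R(1) by (simp add: C_def)
  have T: "norm (F x (z + w) - F x z - D x w) \<le> C * norm w ^ 2" if "x \<in> ?g" "norm w < R / 2" for x w
  proof -
    have "ball z R \<subseteq> S" using R(2) ball_subset_cball by blast
    from holo_on_Taylor_bound[OF holo_on_subset[OF hol[OF that(1)] this] R(1) M[OF that(1)]
        D(1)[OF that(1)] D(2)[OF that(1)] that(2)]
    show ?thesis by (simp add: C_def)
  qed
  have Dlin: "linear (D x)" if "x \<in> ?g" for x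
    using D(1)[OF that] by (rule has_derivative_linear)
  have cF: "continuous_on ?g (\<lambda>x. F x y)" if "y \<in> S" for y
    by (rule continuous_on_param1[OF cont that])
  \<comment> \<open>\<open>D x w\<close> is a uniform limit of difference quotients, which are
    continuous in \<open>x\<close>; the resulting continuity makes it integrable over the
    segment.\<close>
  have cD: "continuous_on ?g (\<lambda>x. D x w)" for w
  proof (rule uniform_limit_theorem[where F = "at_right (0::real)"])
    define d where "d = R / (2 * norm w + 1)"
    have "0 < d" using R(1) by (simp add: d_def add_nonneg_pos)
    have d: "norm (t *\<^sub>R w) < R / 2" if "0 < t" "t < d" for t
    proof -
      have "t * (2 * norm w + 1) < R" using that by (simp add: d_def pos_less_divide_eq add_nonneg_pos)
      then show ?thesis using that by (simp add: algebra_simps)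
    qed
    show "\<forall>\<^sub>F t in at_right 0. continuous_on ?g (\<lambda>x. (F x (z + t *\<^sub>R w) - F x z) / of_real t)"
      unfolding eventually_at_right_field
    proof (intro exI[of _ d] conjI allI impI \<open>0 < d\<close>)
      fix t assume "0 < t" "t < d"
      then have "z + t *\<^sub>R w \<in> S" using d[of t] R by (intro subsetD[OF R(2)]) (simp add: dist_norm)
      then show "continuous_on ?g (\<lambda>x. (F x (z + t *\<^sub>R w) - F x z) / of_real t)"
        using \<open>0 < t\<close> \<open>z \<in> S\<close> by (intro continuous_intros cF) auto
    qed
    show "uniform_limit ?g (\<lambda>t x. (F x (z + t *\<^sub>R w) - F x z) / of_real t) (\<lambda>x. D x w) (at_right 0)"
    proof (rule uniform_limitI)
      fix e :: real assume "0 < e"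
      \<comment> \<open>The quotient differs from its limit by at most
        \<open>t * (C * norm w ^ 2)\<close>; the added 1 keeps the divisor positive when
        \<open>w = 0\<close>.\<close>
      define d' where "d' = min d (e / (C * norm w ^ 2 + 1))"
      have "0 < d'" using \<open>0 < d\<close> \<open>0 < e\<close> \<open>0 < C\<close> by (simp add: d'_def add_nonneg_pos)
      show "\<forall>\<^sub>F t in at_right 0. \<forall>x\<in>?g. dist ((F x (z + t *\<^sub>R w) - F x z) / of_real t) (D x w) < e"
        unfolding eventually_at_right_field
      proof (intro exI[of _ d'] conjI allI impI ballI \<open>0 < d'\<close>)
        fix t x assume t: "0 < t" "t < d'" and "x \<in> ?g"
        have "norm (F x (z + t *\<^sub>R w) - F x z - t *\<^sub>R D x w) \<le> C * norm (t *\<^sub>R w) ^ 2"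
          using T[OF \<open>x \<in> ?g\<close> d[of t]] t Dlin[OF \<open>x \<in> ?g\<close>] by (simp add: d'_def linear_scale)
        also have "\<dots> = t * (t * (C * norm w ^ 2))" by (simp add: power2_eq_square)
        also have "t * (C * norm w ^ 2 + 1) < e"
          using t \<open>0 < C\<close> by (simp add: d'_def pos_less_divide_eq add_nonneg_pos)
        then have "t * (t * (C * norm w ^ 2)) < t * e"
          using t by (intro mult_strict_left_mono) (auto simp: algebra_simps)
        finally have "norm (F x (z + t *\<^sub>R w) - F x z - t *\<^sub>R D x w) / t < e"
          using t by (simp add: field_simps)
        moreover have "(F x (z + t *\<^sub>R w) - F x z) / of_real t - D x w
            = (F x (z + t *\<^sub>R w) - F x z - t *\<^sub>R D x w) / of_real t"
          using t by (simp add: field_simps scaleR_conv_of_real)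
        ultimately show "dist ((F x (z + t *\<^sub>R w) - F x z) / of_real t) (D x w) < e"
          using t by (simp add: dist_norm norm_divide)
      qed
    qed
  qed auto
  have iF: "(\<lambda>x. F x y) contour_integrable_on linepath a b" if "y \<in> S" for y
    using cF[OF that] by (rule contour_integrable_continuous_linepath)
  have iD: "(\<lambda>x. D x w) contour_integrable_on linepath a b" for w
    using cD by (rule contour_integrable_continuous_linepath)
  define L where "L w = ?I (\<lambda>x. D x w)" for w
  have "linear L"
  proof (rule linearI)
    fix v w
    have "L (v + w) = ?I (\<lambda>x. D x v + D x w)"
      unfolding L_def by (intro contour_integral_cong) (auto simp: linear_add[OF Dlin])
    then show "L (v + w) = L v + L w" by (simp add: L_def contour_integral_add iD)
  next
    fix r w
    have "L (r *\<^sub>R w) = ?I (\<lambda>x. of_real r * D x w)"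
      unfolding L_def by (intro contour_integral_cong) (auto simp: linear_scale[OF Dlin] scaleR_conv_of_real)
    then show "L (r *\<^sub>R w) = r *\<^sub>R L w"
      by (simp add: L_def contour_integral_lmul iD scaleR_conv_of_real)
  qed
  have "((\<lambda>z. ?I (\<lambda>x. F x z)) has_derivative L) (at z)"
    unfolding has_derivative_at_alt
  proof (intro conjI allI impI)
    show "bounded_linear L" using \<open>linear L\<close> by (simp add: linear_conv_bounded_linear)
    fix e :: real assume "0 < e"
    define d where "d = min (R / 2) (e / (C * norm (b - a) + 1))"
    have "0 < d" using R(1) \<open>0 < e\<close> \<open>0 < C\<close> by (simp add: d_def add_nonneg_pos)
    have "norm (?I (\<lambda>x. F x y) - ?I (\<lambda>x. F x z) - L (y - z)) \<le> e * norm (y - z)"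
      if "norm (y - z) < d" for y
    proof -
      have y: "y \<in> S" using that R by (intro subsetD[OF R(2)]) (simp add: d_def dist_norm norm_minus_commute)
      have "((\<lambda>x. F x y - F x z - D x (y - z)) has_contour_integral
          (?I (\<lambda>x. F x y) - ?I (\<lambda>x. F x z) - L (y - z))) (linepath a b)"
        unfolding L_def using iF iD y \<open>z \<in> S\<close>
        by (intro has_contour_integral_diff has_contour_integral_integral) auto
      then have "norm (?I (\<lambda>x. F x y) - ?I (\<lambda>x. F x z) - L (y - z)) \<le> (C * norm (y - z) ^ 2) * norm (b - a)"
        using T[of _ "y - z"] that \<open>0 < C\<close>
        by (intro has_contour_integral_bound_linepath[where f = "\<lambda>x. F x y - F x z - D x (y - z)"])
           (auto simp: d_def)
      also have "\<dots> = norm (y - z) * (norm (y - z) * (C * norm (b - a)))"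
        by (simp add: power2_eq_square)
      also have "\<dots> \<le> norm (y - z) * e"
      proof (rule mult_left_mono)
        have "norm (y - z) * (C * norm (b - a) + 1) < e"
          using that \<open>0 < C\<close> by (simp add: d_def pos_less_divide_eq add_nonneg_pos)
        then show "norm (y - z) * (C * norm (b - a)) \<le> e"
          using norm_ge_zero[of "y - z"] by (simp only: distrib_left mult_1_right)
      qed simp
      finally show ?thesis by (simp add: mult.commute)
    qed
    then show "\<exists>d>0. \<forall>y. norm (y - z) < d \<longrightarrow>
        norm (?I (\<lambda>x. F x y) - ?I (\<lambda>x. F x z) - L (y - z)) \<le> e * norm (y - z)"
      using \<open>0 < d\<close> by blast
  qed
  moreover have "L (cscale \<i> v) = \<i> * L v" for v
  proof -
    have "L (cscale \<i> v) = ?I (\<lambda>x. \<i> * D x v)"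
      unfolding L_def by (intro contour_integral_cong refl) (simp only: path_image_linepath D(2)[THEN spec])
    then show ?thesis by (simp add: L_def contour_integral_lmul iD)
  qed
  ultimately show "\<exists>f'. ((\<lambda>z. ?I (\<lambda>x. F x z)) has_derivative f') (at z) \<and> (\<forall>v. f' (cscale \<i> v) = \<i> * f' v)"
    by blast
qed

section \<open>Continuation along a family of rectangles\<close>

lemma rectpath_integral_split:
  assumes "continuous_on (path_image (rectpath a b)) f"
  shows "contour_integral (rectpath a b) f =
    contour_integral (linepath a (Complex (Re b) (Im a))) f +
    contour_integral (linepath (Complex (Re b) (Im a)) b) f +
    contour_integral (linepath b (Complex (Re a) (Im b))) f +
    contour_integral (linepath (Complex (Re a) (Im b)) a) f"
proof -
  have "path_image (rectpath a b) = closed_segment a (Complex (Re b) (Im a)) \<union>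
    closed_segment (Complex (Re b) (Im a)) b \<union> closed_segment b (Complex (Re a) (Im b)) \<union>
    closed_segment (Complex (Re a) (Im b)) a"
    by (simp add: rectpath_def Let_def path_image_join Un_assoc)
  then have "f contour_integrable_on linepath a (Complex (Re b) (Im a))"
    "f contour_integrable_on linepath (Complex (Re b) (Im a)) b"
    "f contour_integrable_on linepath b (Complex (Re a) (Im b))"
    "f contour_integrable_on linepath (Complex (Re a) (Im b)) a"
    using assms by (auto intro!: contour_integrable_continuous_linepath intro: continuous_on_subset)
  then show ?thesis
    by (simp add: rectpath_def Let_def algebra_simps)
qed

lemma rectpath_segments:
  "closed_segment a (Complex (Re b) (Im a)) \<subseteq> path_image (rectpath a b)"
  "closed_segment (Complex (Re b) (Im a)) b \<subseteq> path_image (rectpath a b)"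
  "closed_segment b (Complex (Re a) (Im b)) \<subseteq> path_image (rectpath a b)"
  "closed_segment (Complex (Re a) (Im b)) a \<subseteq> path_image (rectpath a b)"
  by (auto simp add: rectpath_def Let_def path_image_join Un_assoc)

lemma rectpath_integral_holomorphic:
  assumes cont: "continuous_on (path_image (rectpath a b) \<times> S) (\<lambda>(x, y). F x y)" and "open S"
    and hol: "\<And>x. x \<in> path_image (rectpath a b) \<Longrightarrow> F x holomorphic_on S"
  shows "(\<lambda>y. contour_integral (rectpath a b) (\<lambda>x. F x y)) holomorphic_on S"
proof -
  have "(\<lambda>y. contour_integral (linepath u v) (\<lambda>x. F x y)) holomorphic_on S"
    if "closed_segment u v \<subseteq> path_image (rectpath a b)" for u v
  proof (rule linepath_integral_holomorphic[OF continuous_on_subset[OF cont] \<open>open S\<close>])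
    show "F x holomorphic_on S" if "x \<in> closed_segment u v" for x
      using that \<open>closed_segment u v \<subseteq> _\<close> by (intro hol) auto
  qed (use that in auto)
  then have "(\<lambda>y. contour_integral (linepath a (Complex (Re b) (Im a))) (\<lambda>x. F x y) +
    contour_integral (linepath (Complex (Re b) (Im a)) b) (\<lambda>x. F x y) +
    contour_integral (linepath b (Complex (Re a) (Im b))) (\<lambda>x. F x y) +
    contour_integral (linepath (Complex (Re a) (Im b)) a) (\<lambda>x. F x y)) holomorphic_on S"
    using rectpath_segments by (intro holomorphic_on_add) auto
  then show ?thesis
    by (rule holomorphic_transform) (simp add: rectpath_integral_split continuous_on_param1[OF cont])
qed

lemma rectpath_integral_holo:
  assumes cont: "continuous_on (path_image (rectpath a b) \<times> S) (\<lambda>(x, y). F x y)" and "open S"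
    and hol: "\<And>x. x \<in> path_image (rectpath a b) \<Longrightarrow> holo_on (F x) S"
  shows "holo_on (\<lambda>y. contour_integral (rectpath a b) (\<lambda>x. F x y)) S"
proof -
  have "holo_on (\<lambda>y. contour_integral (linepath u v) (\<lambda>x. F x y)) S"
    if "closed_segment u v \<subseteq> path_image (rectpath a b)" for u v
  proof (rule linepath_integral_holo[OF continuous_on_subset[OF cont] \<open>open S\<close>])
    show "holo_on (F x) S" if "x \<in> closed_segment u v" for x
      using that \<open>closed_segment u v \<subseteq> _\<close> by (intro hol) auto
  qed (use that in auto)
  then have "holo_on (\<lambda>y. contour_integral (linepath a (Complex (Re b) (Im a))) (\<lambda>x. F x y) +
    contour_integral (linepath (Complex (Re b) (Im a)) b) (\<lambda>x. F x y) +
    contour_integral (linepath b (Complex (Re a) (Im b))) (\<lambda>x. F x y) +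
    contour_integral (linepath (Complex (Re a) (Im b)) a) (\<lambda>x. F x y)) S"
    using rectpath_segments by (intro holo_on_add) auto
  then show ?thesis
    by (rule holo_on_cong[OF \<open>open S\<close>, rotated])
       (simp add: rectpath_integral_split continuous_on_param1[OF cont])
qed

text \<open>Cauchy's integral over the rim, where \<open>f\<close> is available for every
  \<open>\<sigma>\<close> in [0, 1], defines \<open>G\<close> even where the image of the interior
  has left \<open>\<Omega>\<close>; the shift by \<open>z\<close> makes \<open>G \<xi>\<close> a
  function on a full ball of C^n. On \<open>K\<close> the image never leaves
  \<open>\<Omega>\<close>, so there \<open>G\<close> can be compared with \<open>f\<close>.\<close>

lemma rectangle_continuation:
  fixes f :: "'m::finite cpt \<Rightarrow> complex" and \<phi> :: "complex \<Rightarrow> complex \<Rightarrow> 'm cpt"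
  assumes f: "holo_on f \<Omega>" "open \<Omega>"
    and D: "open D" "cbox a b \<subseteq> D"
    and cont: "continuous_on (UNIV \<times> D) (\<lambda>(\<sigma>, \<xi>). \<phi> \<sigma> \<xi>)"
    and d1: "\<And>\<sigma> \<xi>. \<xi> \<in> D \<Longrightarrow> holo_curve_at (\<lambda>\<sigma>. \<phi> \<sigma> \<xi>) \<sigma>"
    and d2: "\<And>\<sigma> \<xi>. \<xi> \<in> D \<Longrightarrow> holo_curve_at (\<phi> \<sigma>) \<xi>"
    and ab: "Re a < Re b" "Im a < Im b"
    and start: "\<And>\<xi>. \<xi> \<in> cbox a b \<Longrightarrow> \<phi> 0 \<xi> \<in> \<Omega>"
    and rim: "\<And>\<sigma> \<xi>. \<sigma> \<in> closed_segment 0 1 \<Longrightarrow> \<xi> \<in> path_image (rectpath a b) \<Longrightarrow> \<phi> \<sigma> \<xi> \<in> \<Omega>"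
    and K: "compact K" "K \<subseteq> box a b"
      "\<And>\<sigma> \<xi>. \<sigma> \<in> closed_segment 0 1 \<Longrightarrow> \<xi> \<in> K \<Longrightarrow> \<phi> \<sigma> \<xi> \<in> \<Omega>"
  obtains r G where "0 < r"
    "\<And>\<xi>. \<xi> \<in> box a b \<Longrightarrow> holo_on (G \<xi>) (ball 0 r)"
    "\<And>z. z \<in> ball 0 r \<Longrightarrow> (\<lambda>\<xi>. G \<xi> z) holomorphic_on box a b"
    "\<And>\<xi> z. \<xi> \<in> K \<Longrightarrow> z \<in> ball 0 r \<Longrightarrow> G \<xi> z = f (\<phi> 1 \<xi> + z)"
proof -
  let ?P = "path_image (rectpath a b)" and ?I = "closed_segment 0 (1::complex)"
  have sub: "?P \<subseteq> cbox a b" "box a b \<subseteq> cbox a b"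
    using ab path_image_rectpath_subset_cbox[of a b] box_subset_cbox by auto
  define X where "X = (UNIV \<times> D \<times> UNIV) \<inter> (\<lambda>(\<sigma>, \<xi>, z). \<phi> \<sigma> \<xi> + z) -` \<Omega>"
  have contX: "continuous_on (UNIV \<times> D \<times> UNIV) (\<lambda>(\<sigma>, \<xi>, z). \<phi> \<sigma> \<xi> + z)"
  proof -
    have "continuous_on (UNIV \<times> D \<times> UNIV) (\<lambda>p. (\<lambda>(\<sigma>, \<xi>). \<phi> \<sigma> \<xi>) (fst p, fst (snd p)) + snd (snd p))"
      by (intro continuous_intros continuous_on_compose2[OF cont]) auto
    then show ?thesis by (simp add: case_prod_unfold)
  qed
  have "open X"
    unfolding X_def using contX D(1) f(2)
    by (metis continuous_on_open_vimage open_Times open_UNIV Int_commute)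
  \<comment> \<open>Compactness of the start rectangle, together with the rim and \<open>K\<close>
    over all of [0, 1], yields a uniform margin \<open>e\<close>. It is halved below because
    \<open>\<sigma>\<close> and \<open>z\<close> are both perturbed.\<close>
  define A where "A = (\<lambda>(\<sigma>, \<xi>). (\<sigma>, \<xi>, 0::'m cpt)) ` ({0} \<times> cbox a b \<union> ?I \<times> (?P \<union> K))"
  have "compact A"
    unfolding A_def case_prod_unfold using K(1)
    by (intro compact_continuous_image compact_Un compact_Times continuous_intros compact_path_image)
       (auto intro: valid_path_imp_path)
  moreover have "A \<subseteq> X"
    using D(2) sub K start rim by (auto simp: A_def X_def)
  ultimately obtain e where "0 < e" and e: "(\<Union>x\<in>A. ball x e) \<subseteq> X"
    using compact_subset_open_imp_ball_epsilon_subset[OF _ \<open>open X\<close>] by metis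
  define d where "d = e / 2"
  have "0 < d" using \<open>0 < e\<close> by (simp add: d_def)
  have near: "\<phi> (s + t) \<xi> + z \<in> \<Omega>"
    if "(s, \<xi>, 0) \<in> A" "norm t < d" "norm z < d" for s t \<xi> and z :: "'m cpt"
  proof -
    have "dist (s, \<xi>, 0) (s + t, \<xi>, z) \<le> norm t + norm z"
      by (simp add: dist_Pair_Pair dist_norm[of s] dist_0_norm sqrt_sum_squares_le_sum del: dist_norm)
    then have "(s + t, \<xi>, z) \<in> ball (s, \<xi>, 0) e"
      using that by (simp add: d_def)
    then have "(s + t, \<xi>, z) \<in> X" using e that(1) by blast
    then show ?thesis by (simp add: X_def)
  qed
  \<comment> \<open>The \<open>d\<close>-neighbourhood of [0, 1] in the complex plane: it is convex,
    hence connected, as the identity theorem in \<open>\<sigma>\<close> demands.\<close>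
  define S where "S = (\<Union>x\<in>?I. \<Union>y\<in>ball 0 d. {x + y})"
  have "open S" "convex S"
    unfolding S_def by (intro open_sums convex_sums; simp)+
  have S: "\<exists>s t. \<sigma> = s + t \<and> s \<in> ?I \<and> norm t < d" if "\<sigma> \<in> S" for \<sigma>
    using that unfolding S_def by (force simp only: mem_ball_0 UN_iff singleton_iff)
  have "1 \<in> S" "ball 0 d \<subseteq> S"
    unfolding S_def using \<open>0 < d\<close> by (force intro: bexI[of _ 1] bexI[of _ 0])+
  have inP: "\<phi> \<sigma> \<xi> + z \<in> \<Omega>" if \<sigma>: "\<sigma> \<in> S" "\<xi> \<in> ?P \<union> K" "norm z < d" for \<sigma> \<xi> z
  proof -
    obtain s t where st: "\<sigma> = s + t" "s \<in> ?I" "norm t < d" using S[OF \<sigma>(1)] by blast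
    then have "(s, \<xi>, 0) \<in> A" using that(2) unfolding A_def by force
    then show ?thesis using near st that(3) by blast
  qed
  have inB: "\<phi> \<sigma> \<xi> + z \<in> \<Omega>" if "norm \<sigma> < d" "\<xi> \<in> cbox a b" "norm z < d" for \<sigma> \<xi> z
  proof -
    have "(0, \<xi>, 0) \<in> A" using that(2) unfolding A_def by force
    from near[OF this that(1,3)] show ?thesis by simp
  qed
  have d1': "holo_curve_at (\<lambda>\<sigma>. \<phi> \<sigma> \<xi> + z) \<sigma>" if "\<xi> \<in> D" for \<sigma> \<xi> z
    using d1[OF that] by (rule holo_curve_at_add_const)
  have d2': "holo_curve_at (\<lambda>\<xi>. \<phi> \<sigma> \<xi> + z) \<xi>" if "\<xi> \<in> D" for \<sigma> \<xi> z
    using d2[OF that] by (rule holo_curve_at_add_const)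
  have contf: "continuous_on Y (\<lambda>y. f (\<phi> (p y) (q y) + s y))"
    if "continuous_on Y p" "continuous_on Y q" "continuous_on Y s"
      "\<And>y. y \<in> Y \<Longrightarrow> q y \<in> D \<and> \<phi> (p y) (q y) + s y \<in> \<Omega>"
    for Y :: "'y::topological_space set" and p q s
  proof (rule continuous_on_compose2[OF holo_on_imp_continuous_on[OF f(1)]])
    have "continuous_on Y (\<lambda>y. (\<lambda>(\<sigma>, \<xi>, z). \<phi> \<sigma> \<xi> + z) (p y, q y, s y))"
      by (rule continuous_on_compose2[OF contX]) (use that in \<open>auto intro!: continuous_intros\<close>)
    then show "continuous_on Y (\<lambda>y. \<phi> (p y) (q y) + s y)" by simp
  qed (use that in auto)
  define H where "H \<sigma> \<xi> z = contour_integral (rectpath a b) (\<lambda>x. f (\<phi> \<sigma> x + z) / (x - \<xi>)) / (2 * pi * \<i>)"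
    for \<sigma> \<xi> z
  have notP: "\<xi> \<notin> ?P" if "\<xi> \<in> box a b" for \<xi>
    using that ab by (auto simp: path_image_rectpath_cbox_minus_box)
  \<comment> \<open>For small \<open>\<sigma>\<close> the image of the whole closed rectangle still
    lies in \<open>\<Omega>\<close>, so Cauchy's formula applies.\<close>
  have H_start: "H \<sigma> \<xi> z = f (\<phi> \<sigma> \<xi> + z)" if "norm \<sigma> < d" "\<xi> \<in> box a b" "norm z < d" for \<sigma> \<xi> z
  proof -
    let ?g = "\<lambda>\<xi>. f (\<phi> \<sigma> \<xi> + z)"
    have hol: "?g holomorphic_on box a b"
      by (rule holomorphic_on_holo_on_curve[OF f(1) open_box])
         (use inB[OF that(1) _ that(3)] d2' sub D in blast)+
    have "((\<lambda>x. ?g x / (x - \<xi>)) has_contour_integral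
        2 * pi * \<i> * winding_number (rectpath a b) \<xi> * ?g \<xi>) (rectpath a b)"
    proof (rule Cauchy_integral_formula_convex[where S = "cbox a b" and K = "{}"])
      show "continuous_on (cbox a b) ?g"
        by (intro contf continuous_intros) (use inB[OF that(1) _ that(3)] D in auto)
      show "?g field_differentiable at x" if "x \<in> interior (cbox a b) - {}" for x
        using hol that by (auto simp: interior_cbox intro: holomorphic_on_imp_differentiable_at)
    qed (use that notP sub in \<open>auto simp: interior_cbox\<close>)
    then show ?thesis
      using winding_number_rectpath[OF that(2)]
      by (simp add: H_def contour_integral_unique)
  qed
  show ?thesis
  proof (rule that[of d "H 1"])
    show "0 < d" by fact
    show "holo_on (H 1 \<xi>) (ball 0 d)" if "\<xi> \<in> box a b" for \<xi>
    proof -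
      have "holo_on (\<lambda>z. contour_integral (rectpath a b) (\<lambda>x. f (\<phi> 1 x + z) / (x - \<xi>))) (ball 0 d)"
      proof (rule rectpath_integral_holo)
        show "continuous_on (?P \<times> ball 0 d) (\<lambda>(x, z). f (\<phi> 1 x + z) / (x - \<xi>))"
          unfolding case_prod_unfold using inP[OF \<open>1 \<in> S\<close>] notP[OF that] sub D
          by (intro continuous_intros contf) auto
        fix x assume x: "x \<in> ?P"
        have "holo_on (\<lambda>z. inverse (x - \<xi>) * f (z + \<phi> 1 x)) (ball 0 d)"
          by (rule holo_on_cmult, rule holo_on_subset[OF holo_on_translate[OF f(1)]])
             (use inP[OF \<open>1 \<in> S\<close>] x in \<open>auto simp: add.commute\<close>)
        then show "holo_on (\<lambda>z. f (\<phi> 1 x + z) / (x - \<xi>)) (ball 0 d)"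
          by (simp add: field_simps)
      qed simp
      from holo_on_cmult[OF this, of "1 / (2 * pi * \<i>)"] show ?thesis
        by (simp add: H_def[abs_def])
    qed
    show "(\<lambda>\<xi>. H 1 \<xi> z) holomorphic_on box a b" if "z \<in> ball 0 d" for z
      unfolding H_def
    proof (rule holomorphic_on_divide[OF rectpath_integral_holomorphic holomorphic_on_const])
      show "continuous_on (?P \<times> box a b) (\<lambda>(x, \<xi>). f (\<phi> 1 x + z) / (x - \<xi>))"
        unfolding case_prod_unfold using inP[OF \<open>1 \<in> S\<close>, of _ z] notP sub D that
        by (intro continuous_intros contf) auto
      show "(\<lambda>\<xi>. f (\<phi> 1 x + z) / (x - \<xi>)) holomorphic_on box a b" if "x \<in> ?P" for x
        using that notP by (intro holomorphic_intros) auto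
    qed auto
    \<comment> \<open>both sides are holomorphic in \<open>\<sigma>\<close> near \<open>[0, 1]\<close>, and Cauchy's formula equates them for small \<open>\<sigma>\<close>\<close>
    show "H 1 \<xi> z = f (\<phi> 1 \<xi> + z)" if "\<xi> \<in> K" "z \<in> ball 0 d" for \<xi> z
    proof (rule analytic_continuation_open[where s = "ball 0 d" and s' = S and z = 1
          and f = "\<lambda>\<sigma>. H \<sigma> \<xi> z" and g = "\<lambda>\<sigma>. f (\<phi> \<sigma> \<xi> + z)"])
      have \<xi>: "\<xi> \<in> box a b" "\<xi> \<in> D" using that K(2) sub D by auto
      show "(\<lambda>\<sigma>. H \<sigma> \<xi> z) holomorphic_on S"
        unfolding H_def
      proof (rule holomorphic_on_divide[OF rectpath_integral_holomorphic holomorphic_on_const])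
        show "continuous_on (?P \<times> S) (\<lambda>(x, \<sigma>). f (\<phi> \<sigma> x + z) / (x - \<xi>))"
          unfolding case_prod_unfold using inP[of _ _ z] notP[OF \<xi>(1)] sub D that
          by (intro continuous_intros contf) auto
        show "(\<lambda>\<sigma>. f (\<phi> \<sigma> x + z) / (x - \<xi>)) holomorphic_on S" if "x \<in> ?P" for x
          using notP[OF \<xi>(1)] that inP[of _ x z] \<open>z \<in> ball 0 d\<close> d1'[of x z] sub D
          by (intro holomorphic_intros holomorphic_on_holo_on_curve[OF f(1) \<open>open S\<close>]) auto
      qed (use \<open>open S\<close> in auto)
      show "(\<lambda>\<sigma>. f (\<phi> \<sigma> \<xi> + z)) holomorphic_on S"
        using that inP[of _ \<xi> z] d1'[OF \<xi>(2), of z] by (intro holomorphic_on_holo_on_curve[OF f(1) \<open>open S\<close>]) auto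
      show "H \<sigma> \<xi> z = f (\<phi> \<sigma> \<xi> + z)" if "\<sigma> \<in> ball 0 d" for \<sigma>
        using H_start[of \<sigma> \<xi> z] that \<open>z \<in> ball 0 d\<close> \<xi> by simp
    qed (use \<open>open S\<close> \<open>convex S\<close> \<open>1 \<in> S\<close> \<open>ball 0 d \<subseteq> S\<close> \<open>0 < d\<close> in \<open>auto intro: convex_connected\<close>)
  qed
qed

section \<open>Minkowski geometry\<close>

lemma mink_inner: "mink a b = fst a * fst b - snd a \<bullet> snd b"
  by (simp add: mink_def inner_vec_def)

lemma mink_simps:
  "mink (a + b) c = mink a c + mink b c" "mink c (a + b) = mink c a + mink c b"
  "mink (a - b) c = mink a c - mink b c" "mink c (a - b) = mink c a - mink c b"
  "mink (r *\<^sub>R a) c = r * mink a c" "mink c (r *\<^sub>R a) = r * mink c a"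
  by (simp_all add: mink_inner algebra_simps inner_add_left inner_add_right inner_diff_left inner_diff_right)

lemma mink_commute: "mink a b = mink b a"
  by (simp add: mink_inner inner_commute)

lemma msq_eq: "msq x = (fst x)\<^sup>2 - (norm (snd x))\<^sup>2"
  by (simp add: msq_def mink_inner dot_square_norm) (simp add: power2_eq_square)

lemma msq_add: "msq (a + b) = msq a + 2 * mink a b + msq b"
  by (simp add: msq_def mink_simps mink_commute[of b a])

lemma msq_scaleR: "msq (r *\<^sub>R a) = r\<^sup>2 * msq a"
  by (simp add: msq_def mink_simps power2_eq_square)

lemma Vplus_iff: "x \<in> Vplus \<longleftrightarrow> norm (snd x) < fst x"
proof
  assume "x \<in> Vplus"
  then have "(norm (snd x))\<^sup>2 < (fst x)\<^sup>2" "0 < fst x" by (auto simp: Vplus_def msq_eq)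
  then show "norm (snd x) < fst x" by (simp add: power2_less_imp_less)
next
  assume *: "norm (snd x) < fst x"
  then have "0 < fst x" using norm_ge_zero by (rule order_le_less_trans[rotated])
  with * show "x \<in> Vplus" by (simp add: Vplus_def msq_eq power_strict_mono)
qed

lemma Vminus_iff: "x \<in> Vminus \<longleftrightarrow> - x \<in> Vplus"
  unfolding Vminus_def by (metis (no_types, lifting) image_iff minus_minus)

lemma open_Vplus: "open (Vplus :: 'a::finite rpt set)"
proof -
  have "open {x :: 'a rpt. norm (snd x) < fst x}"
    by (intro open_Collect_less continuous_intros)
  also have "{x :: 'a rpt. norm (snd x) < fst x} = Vplus" by (auto simp: Vplus_iff)
  finally show ?thesis .
qed

lemma mink_nonneg:
  assumes "norm (snd x) \<le> fst x" "norm (snd y) \<le> fst y"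
  shows "0 \<le> mink x y"
proof -
  have "snd x \<bullet> snd y \<le> norm (snd x) * norm (snd y)" by (rule norm_cauchy_schwarz)
  also have "\<dots> \<le> fst x * fst y"
    using assms by (intro mult_mono) (auto intro: order_trans[OF norm_ge_zero])
  finally show ?thesis by (simp add: mink_inner)
qed

lemma mink_pos:
  assumes "x \<in> Vplus" "norm (snd y) \<le> fst y" "0 < fst y"
  shows "0 < mink x y"
proof -
  have "snd x \<bullet> snd y \<le> norm (snd x) * norm (snd y)" by (rule norm_cauchy_schwarz)
  also have "\<dots> \<le> norm (snd x) * fst y"
    using assms by (intro mult_left_mono) auto
  also have "\<dots> < fst x * fst y"
    using assms by (intro mult_strict_right_mono) (auto simp: Vplus_iff)
  finally show ?thesis by (simp add: mink_inner)
qed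

lemma Vplus_add:
  assumes "x \<in> Vplus" "norm (snd y) \<le> fst y"
  shows "x + y \<in> Vplus"
  using assms norm_triangle_ineq[of "snd x" "snd y"] by (simp add: Vplus_iff)

lemma cpx_add: "cpx (a + b) = cpx a + cpx b"
  by (simp add: cpx_def vec_eq_iff)

lemma cpx_diff: "cpx (a - b) = cpx a - cpx b"
  by (simp add: cpx_def vec_eq_iff)

lemma cscale_cpx: "cscale (of_real r) (cpx a) = cpx (r *\<^sub>R a)"
  by (simp add: cpx_def cscale_def vec_eq_iff)

lemma norm_cpx [simp]: "norm (cpx a) = norm a"
proof -
  have "norm (\<chi> i. complex_of_real (snd a $ i)) = norm (snd a)"
    by (simp add: norm_vec_def)
  then show ?thesis by (simp add: cpx_def norm_prod_def)
qed

lemma im_pt_add: "im_pt (z + w) = im_pt z + im_pt w"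
  by (simp add: im_pt_def vec_eq_iff)

lemma im_pt_cscale_cpx: "im_pt (cscale c (cpx a)) = Im c *\<^sub>R a"
  by (simp add: im_pt_def cscale_def cpx_def vec_eq_iff prod_eq_iff)

lemma bounded_linear_im_pt: "bounded_linear im_pt"
  unfolding linear_conv_bounded_linear[symmetric]
  by (rule linearI) (simp_all add: im_pt_def vec_eq_iff prod_eq_iff)

lemma open_Tplus: "open Tplus"
  using open_vimage[OF open_Vplus linear_continuous_on[OF bounded_linear_im_pt]]
  by (simp add: Tplus_def vimage_def)

lemma open_Tminus: "open (Tminus :: 'a::finite cpt set)"
proof -
  have "(Tminus :: 'a cpt set) = uminus -` Tplus"
  proof -
    have "im_pt (- z) = - im_pt z" for z :: "'a cpt"
      by (rule linear_neg[OF bounded_linear.linear[OF bounded_linear_im_pt]])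
    then show ?thesis unfolding Tplus_def Tminus_def vimage_def by (simp add: Vminus_iff)
  qed
  moreover have "open (uminus -` (Tplus :: 'a cpt set))"
    using open_Tplus by (intro open_vimage continuous_intros)
  ultimately show ?thesis by simp
qed

text \<open>A frontier point of \<open>B\<close> cannot lie in the ball, which is open and inside
  \<open>B\<close>; so the distance to the frontier is at least \<open>\<rho>\<close>.
  \<open>B \<noteq> UNIV\<close> keeps the frontier nonempty: \<open>infdist\<close> to the empty
  set is 0 by convention.\<close>

lemma tildeI:
  assumes "ball x \<rho> \<subseteq> B" "0 < \<rho>" "B \<noteq> UNIV" "norm (z - cpx x) < \<rho> / 32"
  shows "z \<in> tilde B"
proof -
  have "x \<in> B" using assms(1,2) centre_in_ball by blast
  then have "frontier B \<noteq> {}" using assms(3) frontier_eq_empty by blast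
  moreover have "\<rho> \<le> dist x y" if "y \<in> frontier B" for y
    using that assms(1) interior_maximal[OF assms(1)] by (force simp: frontier_def)
  ultimately have "\<rho> \<le> infdist x (frontier B)"
    by (simp add: infdist_notempty cINF_greatest)
  then show ?thesis using \<open>x \<in> B\<close> assms(4) by (force simp: tilde_def)
qed

text \<open>For \<open>x = (t, y)\<close> and \<open>e = y /\<^sub>R norm y\<close> the null
  directions are \<open>(1, e)\<close> and \<open>(1, - e)\<close>. The coefficients, half of
  \<open>norm y + t\<close> and of \<open>norm y - t\<close>, are positive because \<open>x\<close>
  is spacelike.\<close>

lemma null_frame:
  assumes "x \<in> Rspace"
  obtains p q where "norm (snd p) = fst p" "norm (snd q) = fst q" "0 < fst p" "0 < fst q"
    "0 < mink p q" "x = q - p"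
proof -
  define t y where "t = fst x" and "y = snd x"
  have "t\<^sup>2 < (norm y)\<^sup>2"
    using assms by (simp add: Rspace_def ccompl_def msq_eq t_def y_def)
  then have ty: "\<bar>t\<bar> < norm y"
    by (metis abs_norm_cancel abs_le_square_iff not_le power2_abs)
  define e where "e = y /\<^sub>R norm y"
  have e: "norm e = 1" "y = norm y *\<^sub>R e" using ty by (cases "y = 0"; simp add: e_def)+
  define \<alpha> \<beta> where "\<alpha> = (norm y - t) / 2" and "\<beta> = (norm y + t) / 2"
  have \<alpha>\<beta>: "0 < \<alpha>" "0 < \<beta>" using ty by (auto simp: \<alpha>_def \<beta>_def)
  have "e \<bullet> e = 1" using e(1) by (simp add: power2_norm_eq_inner[symmetric])
  moreover have "x = (\<beta>, \<beta> *\<^sub>R e) - (\<alpha>, - \<alpha> *\<^sub>R e)"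
  proof -
    have "\<beta> - \<alpha> = t" "\<beta> + \<alpha> = norm y" by (simp_all add: \<alpha>_def \<beta>_def field_simps)
    then show ?thesis
      using e(2) by (simp add: prod_eq_iff t_def[symmetric] y_def[symmetric] flip: scaleR_left.add)
  qed
  ultimately show ?thesis
    using \<alpha>\<beta> e(1)
    by (intro that[of "(\<alpha>, - \<alpha> *\<^sub>R e)" "(\<beta>, \<beta> *\<^sub>R e)"]) (auto simp: mink_inner)
qed

section \<open>The complex plane spanned by two null vectors\<close>

locale null_pair =
  fixes p q :: "'m::finite rpt"
  assumes null: "norm (snd p) = fst p" "norm (snd q) = fst q"
    and pos: "0 < fst p" "0 < fst q" "0 < mink p q"
begin

text \<open>Complexified light-cone coordinates; the spacelike point \<open>q - p\<close> is
  \<open>pt (- 1) 1\<close>.\<close>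

definition pt :: "complex \<Rightarrow> complex \<Rightarrow> 'm cpt" where
  "pt u v = cscale u (cpx p) + cscale v (cpx q)"

lemma msq_null: "msq p = 0" "msq q = 0"
  using null by (simp_all add: msq_eq)

lemma pt_of_real: "pt (of_real u) (of_real v) = cpx (u *\<^sub>R p + v *\<^sub>R q)"
  by (simp add: pt_def cscale_cpx cpx_add)

lemma msq_comb: "msq (u *\<^sub>R p + v *\<^sub>R q) = 2 * u * v * mink p q"
  by (simp add: msq_add msq_scaleR msq_null mink_simps)

lemma comb_Vplus: "0 < u \<Longrightarrow> 0 < v \<Longrightarrow> u *\<^sub>R p + v *\<^sub>R q \<in> Vplus"
  using pos by (simp add: Vplus_def msq_comb add_pos_pos)

lemma pt_Tplus: "0 < Im u \<Longrightarrow> 0 < Im v \<Longrightarrow> pt u v \<in> Tplus"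
  by (simp add: Tplus_def pt_def im_pt_add im_pt_cscale_cpx comb_Vplus)

lemma pt_Tminus: "Im u < 0 \<Longrightarrow> Im v < 0 \<Longrightarrow> pt u v \<in> Tminus"
  using comb_Vplus[of "- Im u" "- Im v"]
  by (simp add: Tminus_def Vminus_iff pt_def im_pt_add im_pt_cscale_cpx)

text \<open>Two linear inequalities cut out an open set inside the causal complement. For
  \<open>d\<close> in the double cone they make the product of \<open>y - d\<close> with
  \<open>q\<close> negative and with \<open>p\<close> positive, whereas a vector that is not
  spacelike has products of one sign, possibly zero, with both future null vectors.\<close>

lemma pt_tilde_Dcone:
  assumes "s \<in> Vplus" "u < 0" "mink s p < v * mink p q"
  shows "pt (of_real u) (of_real v) \<in> tilde (ccompl (Dcone 0 s))"
proof -
  let ?L = "{y. mink y q < 0 \<and> mink s p < mink y p}"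
  have "open ?L"
    unfolding mink_inner by (intro open_Collect_conj open_Collect_less continuous_intros)
  moreover have "u *\<^sub>R p + v *\<^sub>R q \<in> ?L"
    using assms pos msq_null
    by (simp add: mink_simps msq_def[symmetric] mink_commute[of q p] mult_neg_pos)
  ultimately obtain \<rho> where \<rho>: "0 < \<rho>" "ball (u *\<^sub>R p + v *\<^sub>R q) \<rho> \<subseteq> ?L"
    using openE by blast
  have sub: "?L \<subseteq> ccompl (Dcone 0 s)"
  proof
    fix y assume y: "y \<in> ?L"
    have "msq (y - d) < 0" if "d \<in> Dcone 0 s" for d
    proof (rule ccontr)
      assume "\<not> msq (y - d) < 0"
      then have "(norm (snd (y - d)))\<^sup>2 \<le> (fst (y - d))\<^sup>2" by (simp add: msq_eq del: fst_diff snd_diff)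
      then have cone: "norm (snd (y - d)) \<le> \<bar>fst (y - d)\<bar>"
        by (metis abs_norm_cancel abs_le_square_iff)
      have d: "d \<in> Vplus" "s - d \<in> Vplus"
        using that by (auto simp: Dcone_def Vminus_iff algebra_simps)
      have "0 < mink d q" "0 < mink (s - d) p" using mink_pos[OF d(1), of q] mink_pos[OF d(2), of p] null pos by simp_all
      then have *: "mink (y - d) q < 0" "0 < mink (y - d) p" using y by (auto simp: mink_simps)
      show False
      proof (cases "0 \<le> fst (y - d)")
        case True
        then show False using * mink_nonneg[of "y - d" q] null cone by auto
      next
        case False
        then have "0 \<le> mink (- (y - d)) p"
          using null cone by (intro mink_nonneg) (auto simp: norm_minus_commute)
        moreover have "mink (- (y - d)) p = - mink (y - d) p"
          by (simp add: mink_inner algebra_simps inner_diff_left)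
        ultimately show False using * by simp
      qed
    qed
    then show "y \<in> ccompl (Dcone 0 s)" by (simp add: ccompl_def)
  qed
  \<comment> \<open>A point of the double cone, not spacelike to itself: the causal complement is
    therefore not the whole space, as \<open>tildeI\<close> requires.\<close>
  have "(1/2) *\<^sub>R s \<in> Dcone 0 s"
  proof -
    have "(1/2) *\<^sub>R s \<in> Vplus" using assms(1) by (simp add: Vplus_iff)
    moreover have "(1/2) *\<^sub>R s = s + - ((1/2) *\<^sub>R s)" by (simp add: prod_eq_iff algebra_simps flip: scaleR_left.add)
    ultimately show ?thesis unfolding Dcone_def Vminus_def by (auto intro!: image_eqI)
  qed
  then have "(1/2) *\<^sub>R s \<notin> ccompl (Dcone 0 s)"
    unfolding ccompl_def by (force simp: msq_eq intro!: bexI[of _ "(1/2) *\<^sub>R s"])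
  then show ?thesis
    unfolding pt_of_real using \<rho> sub by (intro tildeI[where \<rho> = \<rho>]) auto
qed

text \<open>The tolerance \<open>c\<close> depends on \<open>p\<close> and \<open>q\<close> alone:
  one fixed ball inside the forward cone is translated by a vector \<open>?a\<close> of square above
  \<open>\<mu>\<^sup>2\<close>, and adding a future timelike vector to \<open>?a\<close> only
  increases the square.\<close>

lemma pt_tilde_Vmu:
  obtains c where "0 < c"
    "\<And>\<mu> u v. 1/4 \<le> u \<Longrightarrow> 1/4 \<le> Re v \<Longrightarrow> \<bar>Im v\<bar> < c \<Longrightarrow> 2 * \<mu>\<^sup>2 < mink p q * u * Re v \<Longrightarrow>
      pt (of_real u) v \<in> tilde (Vmu \<mu>)"
proof -
  have "(1/8) *\<^sub>R p + (1/8) *\<^sub>R q \<in> Vplus" by (rule comb_Vplus) auto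
  then obtain \<rho> where \<rho>: "0 < \<rho>" "ball ((1/8) *\<^sub>R p + (1/8) *\<^sub>R q) \<rho> \<subseteq> Vplus"
    using open_Vplus openE by blast
  have "0 < norm q" using pos by auto
  show ?thesis
  proof (rule that[of "\<rho> / (32 * norm q)"])
    show "0 < \<rho> / (32 * norm q)" using \<rho> \<open>0 < norm q\<close> by simp
    fix \<mu> u :: real and v
    assume u: "1/4 \<le> u" and v: "1/4 \<le> Re v" "\<bar>Im v\<bar> < \<rho> / (32 * norm q)"
      and uv: "2 * \<mu>\<^sup>2 < mink p q * u * Re v"
    let ?x = "u *\<^sub>R p + Re v *\<^sub>R q" and ?a = "(u - 1/8) *\<^sub>R p + (Re v - 1/8) *\<^sub>R q"
    have a: "?a \<in> Vplus" using u v by (intro comb_Vplus) auto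
    \<comment> \<open>Subtracting 1/8 at most halves a coordinate that is at least 1/4. The loss of
      a factor 4 in the product is the origin of \<open>2 * \<mu>\<^sup>2\<close> in the
      hypothesis.\<close>
    have "u / 2 * (Re v / 2) \<le> (u - 1/8) * (Re v - 1/8)"
      using u v by (intro mult_mono) auto
    then have "\<mu>\<^sup>2 < 2 * (u - 1/8) * (Re v - 1/8) * mink p q"
      using uv mult_right_mono[of "u / 2 * (Re v / 2)" "(u - 1/8) * (Re v - 1/8)" "2 * mink p q"] pos
      by (simp add: algebra_simps)
    then have msqa: "\<mu>\<^sup>2 < msq ?a" by (simp only: msq_comb)
    have "ball ?x \<rho> \<subseteq> Vmu \<mu>"
    proof
      fix y assume "y \<in> ball ?x \<rho>"
      define w where "w = y - ?a"
      have "w \<in> Vplus"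
      proof (rule subsetD[OF \<rho>(2)])
        have "(1/8) *\<^sub>R p + (1/8) *\<^sub>R q - w = ?x - y"
          by (simp add: w_def algebra_simps)
        then show "w \<in> ball ((1/8) *\<^sub>R p + (1/8) *\<^sub>R q) \<rho>"
          using \<open>y \<in> ball ?x \<rho>\<close> by (simp only: mem_ball dist_norm)
      qed
      have "0 < mink ?a w" using a \<open>w \<in> Vplus\<close>
        by (intro mink_pos) (auto simp: Vplus_def Vplus_iff[symmetric] intro: less_imp_le[OF Vplus_iff[THEN iffD1]])
      moreover have "0 < msq w" "0 < fst w" "0 < fst ?a" using a \<open>w \<in> Vplus\<close> by (auto simp: Vplus_def)
      moreover have "y = ?a + w" by (simp add: w_def)
      ultimately show "y \<in> Vmu \<mu>"
        using msqa msq_add[of ?a w] unfolding Vmu_def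
        by (simp del: fst_diff snd_diff fst_scaleR)
    qed
    moreover have "0 \<notin> Vmu \<mu>" by (simp add: Vmu_def)
    moreover have "norm (pt (of_real u) v - cpx ?x) < \<rho> / 32"
    proof -
      have "pt (of_real u) v - cpx ?x = cscale (v - of_real (Re v)) (cpx q)"
        using cscale_add_left[of "v - of_real (Re v)" "of_real (Re v)" "cpx q"]
        by (simp add: pt_def cpx_add cscale_cpx)
      also have "v - of_real (Re v) = \<i> * of_real (Im v)" by (simp add: complex_eq_iff)
      finally show ?thesis
        using v \<open>0 < norm q\<close> by (simp add: norm_cscale norm_mult field_simps)
    qed
    ultimately show "pt (of_real u) v \<in> tilde (Vmu \<mu>)"
      using \<rho>(1) by (intro tildeI[of ?x \<rho>]) auto
  qed
qed

end

section \<open>The family of discs in the plane of two null vectors\<close>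

text \<open>\<open>B\<close> is the height a real \<open>v\<close> must exceed to reach the causal
  complement, \<open>\<kappa>\<close> keeps the imaginary part of \<open>v\<close> on the cut small,
  and \<open>A\<close> moves the cut so far out that the product of \<open>u\<close> and
  \<open>v\<close> is large enough for \<open>Vmu\<close>.\<close>

locale disc_family =
  fixes B \<kappa> A :: real
  assumes B: "1 \<le> B" and \<kappa>: "0 < \<kappa>" "\<kappa> \<le> 1 / 64" and A: "4 \<le> A"
begin

text \<open>
  \<open>X\<close> is the turning point of the cubic in \<open>w 1\<close>, so that \<open>L > X\<close> makes it decrease near both ends. The
  rectangle is placed so that its left edge lies over \<open>u = - \<delta>\<close> and \<open>x\<^sub>0\<close> over \<open>u = - 1\<close>; \<open>\<beta>\<^sub>0\<close> is chosen
  to give \<open>v 1 x\<^sub>0 = 1\<close>, and \<open>\<beta>\<^sub>1\<close> so that \<open>v 0 > B\<close> on the whole real axis.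
\<close>

definition "X = B / \<kappa>"
definition "L = X + 2"
definition "\<delta> = 1 / (4 * B)"
definition "x\<^sub>0 = ln ((A + 1) / (A + \<delta>)) - L"
definition "\<beta>\<^sub>0 = 1 / 2 - \<kappa> * (x\<^sub>0 - x\<^sub>0 ^ 3 / (3 * X\<^sup>2))"
definition "\<beta>\<^sub>1 = B + 1 + 5 * \<kappa> * X"
text \<open>Vertical segments of the rectangle become circles about \<open>A\<close> of radius at
  least \<open>A + \<delta>\<close>, so 0 is never hit. The real axis goes to real \<open>u\<close>
  at most \<open>- \<delta>\<close>, and both edges with imaginary part \<pi> or -\<pi> go to the
  cut.\<close>

definition u :: "complex \<Rightarrow> complex" where
  "u \<xi> = of_real A - of_real ((A + \<delta>) * exp L) * exp \<xi>"
text \<open>The parameter moves the linear coefficient from \<open>- \<kappa>\<close> to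
  \<open>\<kappa>\<close>: at \<open>\<sigma> = 0\<close> the cubic decreases along the whole real
  axis, at \<open>\<sigma> = 1\<close> it climbs between \<open>- X\<close> and
  \<open>X\<close>.\<close>

definition w :: "complex \<Rightarrow> complex \<Rightarrow> complex" where
  "w \<sigma> \<xi> = of_real \<beta>\<^sub>1 + \<sigma> * of_real (\<beta>\<^sub>0 - \<beta>\<^sub>1)
     + of_real \<kappa> * ((2 * \<sigma> - 1) * \<xi> - \<xi> ^ 3 / of_real (3 * X\<^sup>2))"
text \<open>The imaginary part of the pole term has the sign of \<open>Im (u \<xi>)\<close>. By the
  choice of \<open>\<delta>\<close> the term equals \<open>2 * B\<close> at
  \<open>u = - \<delta>\<close>; at \<open>u = - 1\<close> it equals 1/2.\<close>

definition v :: "complex \<Rightarrow> complex \<Rightarrow> complex" where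
  "v \<sigma> \<xi> = w \<sigma> \<xi> - 1 / (2 * u \<xi>)"

lemma X: "64 \<le> X" "\<kappa> * X = B"
proof -
  have "64 * \<kappa> \<le> B" using B \<kappa> by simp
  then show "64 \<le> X" using \<kappa> by (simp add: X_def pos_le_divide_eq)
  show "\<kappa> * X = B" using \<kappa> by (simp add: X_def)
qed

lemma \<delta>: "0 < \<delta>" "\<delta> \<le> 1 / 4" "1 / (2 * \<delta>) = 2 * B"
  using B by (simp_all add: \<delta>_def field_simps)

lemma pi2: "pi\<^sup>2 < 16"
  using pi_less_4 pi_gt_zero power_strict_mono[of pi 4 2] by simp

text \<open>The logarithm lies between 0 and 1, so \<open>x\<^sub>0\<close> is close to the left
  edge and beyond the turning point \<open>- X\<close>, where the cubic decreases for every
  parameter in [0, 1].\<close>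

lemma x0: "- L < x\<^sub>0" "x\<^sub>0 \<le> - (X + 1)"
proof -
  have "0 < ln ((A + 1) / (A + \<delta>))" using \<delta> A by (intro ln_gt_zero) (simp add: field_simps)
  then show "- L < x\<^sub>0" by (simp add: x\<^sub>0_def)
  have "ln ((A + 1) / (A + \<delta>)) \<le> (A + 1) / (A + \<delta>) - 1"
    using \<delta> A by (intro ln_le_minus_one) simp
  also have "\<dots> \<le> 1" using \<delta> A by (simp add: field_simps)
  finally show "x\<^sub>0 \<le> - (X + 1)" by (simp add: x\<^sub>0_def L_def)
qed

lemma Re_u: "Re (u \<xi>) = A - (A + \<delta>) * exp (L + Re \<xi>) * cos (Im \<xi>)"
  and Im_u: "Im (u \<xi>) = - ((A + \<delta>) * exp (L + Re \<xi>) * sin (Im \<xi>))"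
  by (simp_all add: u_def Re_exp Im_exp exp_add algebra_simps)

lemma exp_ge: "- L \<le> x \<Longrightarrow> A + \<delta> \<le> (A + \<delta>) * exp (L + x)"
  using A \<delta> by simp

lemma u_nonzero:
  assumes "- L \<le> Re \<xi>" shows "u \<xi> \<noteq> 0"
proof
  assume "u \<xi> = 0"
  then have "norm (of_real ((A + \<delta>) * exp L) * exp \<xi>) = norm (complex_of_real A)"
    by (simp only: u_def right_minus_eq)
  then have "(A + \<delta>) * exp (L + Re \<xi>) = A"
    using A \<delta> by (simp add: norm_mult exp_add abs_mult del: of_real_mult of_real_add)
  then show False using exp_ge[OF assms] \<delta> by simp
qed

lemma u_x0: "u (of_real x\<^sub>0) = - 1"
proof -
  have "(A + \<delta>) * exp (L + x\<^sub>0) = A + 1"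
    using A \<delta> by (simp add: x\<^sub>0_def)
  then show ?thesis by (simp add: complex_eq_iff Re_u Im_u)
qed

lemma Re_w: "Re (w (of_real s) \<xi>) = \<beta>\<^sub>1 + s * (\<beta>\<^sub>0 - \<beta>\<^sub>1)
    + \<kappa> * ((2 * s - 1) * Re \<xi> - (Re \<xi> ^ 3 - 3 * Re \<xi> * (Im \<xi>)\<^sup>2) / (3 * X\<^sup>2))"
  and Im_w: "Im (w (of_real s) \<xi>) = \<kappa> * Im \<xi> * ((2 * s - 1) - (3 * (Re \<xi>)\<^sup>2 - (Im \<xi>)\<^sup>2) / (3 * X\<^sup>2))"
proof -
  have *: "Re (\<xi> ^ 3) = Re \<xi> ^ 3 - 3 * Re \<xi> * (Im \<xi>)\<^sup>2" "Im (\<xi> ^ 3) = Im \<xi> * (3 * (Re \<xi>)\<^sup>2 - (Im \<xi>)\<^sup>2)"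
    by (simp_all add: power3_eq_cube power2_eq_square algebra_simps)
  have **: "w (of_real s) \<xi> = of_real (\<beta>\<^sub>1 + s * (\<beta>\<^sub>0 - \<beta>\<^sub>1)) + of_real \<kappa> * (of_real (2 * s - 1) * \<xi> - \<xi> ^ 3 / of_real (3 * X\<^sup>2))"
    by (simp add: w_def)
  show "Re (w (of_real s) \<xi>) = \<beta>\<^sub>1 + s * (\<beta>\<^sub>0 - \<beta>\<^sub>1)
    + \<kappa> * ((2 * s - 1) * Re \<xi> - (Re \<xi> ^ 3 - 3 * Re \<xi> * (Im \<xi>)\<^sup>2) / (3 * X\<^sup>2))"
    unfolding ** * [symmetric] by (simp del: of_real_mult of_real_diff of_real_add)
  show "Im (w (of_real s) \<xi>) = \<kappa> * Im \<xi> * ((2 * s - 1) - (3 * (Re \<xi>)\<^sup>2 - (Im \<xi>)\<^sup>2) / (3 * X\<^sup>2))"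
  proof -
    have "Im (w (of_real s) \<xi>) = \<kappa> * ((2 * s - 1) * Im \<xi> - Im (\<xi> ^ 3) / (3 * X\<^sup>2))"
      unfolding ** by (simp del: of_real_mult of_real_diff of_real_add)
    then show ?thesis unfolding *(2) by (simp add: algebra_simps)
  qed
qed

lemma Im_v: "Im (v \<sigma> \<xi>) = Im (w \<sigma> \<xi>) + Im (u \<xi>) / (2 * (norm (u \<xi>))\<^sup>2)"
proof -
  have *: "1 / (2 * u \<xi>) = of_real (1 / 2) * inverse (u \<xi>)" by (simp add: field_simps)
  show ?thesis unfolding v_def * cmod_power2 by simp
qed

lemma Re_v_real: "Im (u \<xi>) = 0 \<Longrightarrow> Re (v \<sigma> \<xi>) = Re (w \<sigma> \<xi>) - 1 / (2 * Re (u \<xi>))"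
  by (simp add: v_def Re_divide power2_eq_square)

text \<open>The second hypothesis makes the last factor in \<open>Im_w\<close> negative. Then
  \<open>w\<close>, \<open>u\<close> and the pole term all have imaginary parts of the sign opposite
  to \<open>Im \<xi>\<close>: points below the real axis belong to \<open>Tplus\<close>, points
  above it to \<open>Tminus\<close>.\<close>

lemma timelike:
  assumes "- L \<le> Re \<xi>" "3 * X\<^sup>2 * (2 * s - 1) < 3 * (Re \<xi>)\<^sup>2 - (Im \<xi>)\<^sup>2" "0 < \<bar>Im \<xi>\<bar>" "\<bar>Im \<xi>\<bar> < pi"
  shows "Im \<xi> < 0 \<Longrightarrow> 0 < Im (u \<xi>) \<and> 0 < Im (v (of_real s) \<xi>)"
    and "0 < Im \<xi> \<Longrightarrow> Im (u \<xi>) < 0 \<and> Im (v (of_real s) \<xi>) < 0"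
proof -
  have "0 < norm (u \<xi>)" using u_nonzero[OF assms(1)] by simp
  have "(2 * s - 1) - (3 * (Re \<xi>)\<^sup>2 - (Im \<xi>)\<^sup>2) / (3 * X\<^sup>2) < 0"
    using assms(2) X(1) by (simp add: pos_less_divide_eq mult.commute)
  note neg = this
  have E: "0 < (A + \<delta>) * exp (L + Re \<xi>)" using A \<delta> by simp
  {
    assume "Im \<xi> < 0"
    then have "sin (Im \<xi>) < 0" using sin_gt_zero[of "- Im \<xi>"] assms(4) by simp
    then have "0 < Im (u \<xi>)" using mult_pos_neg[OF E] by (simp add: Im_u)
    moreover have "0 < Im (w (of_real s) \<xi>)"
      using neg \<kappa> \<open>Im \<xi> < 0\<close> unfolding Im_w by (intro mult_neg_neg mult_pos_neg) auto
    ultimately show "0 < Im (u \<xi>) \<and> 0 < Im (v (of_real s) \<xi>)"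
      using \<open>0 < norm (u \<xi>)\<close> by (simp add: Im_v add_pos_pos)
  }
  {
    assume "0 < Im \<xi>"
    then have "0 < sin (Im \<xi>)" using sin_gt_zero[of "Im \<xi>"] assms(4) by simp
    then have "Im (u \<xi>) < 0" using mult_pos_pos[OF E] by (simp add: Im_u)
    moreover have "Im (w (of_real s) \<xi>) < 0"
      using neg \<kappa> \<open>0 < Im \<xi>\<close> unfolding Im_w by (intro mult_pos_neg mult_pos_pos) auto
    ultimately show "Im (u \<xi>) < 0 \<and> Im (v (of_real s) \<xi>) < 0"
      using \<open>0 < norm (u \<xi>)\<close> by (simp add: Im_v add_neg_neg divide_neg_pos)
  }
qed

section \<open>Estimates for the cubic and their consequences on the rectangle\<close>

lemma cubic_lower:
  assumes "x \<le> 2 * X" shows "- (2 * X / 3) \<le> x - x ^ 3 / (3 * X\<^sup>2)"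
proof -
  \<comment> \<open>The cubic has its local minimum at \<open>- X\<close> and takes the same value
    again at \<open>2 * X\<close>; hence the double root and the simple root.\<close>
  have "0 \<le> (x + X)\<^sup>2 * (2 * X - x)" using assms by simp
  also have "\<dots> = 2 * X ^ 3 + 3 * X\<^sup>2 * x - x ^ 3"
    by (simp add: power2_eq_square power3_eq_cube algebra_simps)
  finally have "0 \<le> (2 * X ^ 3 + 3 * X\<^sup>2 * x - x ^ 3) / (3 * X\<^sup>2)" by simp
  also have "\<dots> = 2 * X / 3 + x - x ^ 3 / (3 * X\<^sup>2)"
    using X(1) by (simp add: field_simps power2_eq_square power3_eq_cube)
  finally show ?thesis by simp
qed

text \<open>Just beyond the local maximum at \<open>X\<close> only quadratic and cubic terms in
  \<open>t\<close> are lost, each at most 1/2. This serves at the right edge and, the cubic being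
  odd, at \<open>x\<^sub>0\<close>.\<close>

lemma cubic_near:
  assumes "0 \<le> t" "t \<le> 2"
  shows "2 * X / 3 - 1 \<le> (X + t) - (X + t) ^ 3 / (3 * X\<^sup>2)"
proof -
  have "(X + t) - (X + t) ^ 3 / (3 * X\<^sup>2) = 2 * X / 3 - (t\<^sup>2 / X + t ^ 3 / (3 * X\<^sup>2))"
    using X(1) by (simp add: field_simps power2_eq_square power3_eq_cube)
  moreover have "t\<^sup>2 / X \<le> 1 / 2"
  proof -
    have "t\<^sup>2 \<le> 2\<^sup>2" using assms by (intro power_mono) auto
    then show ?thesis using X(1) by (simp add: field_simps)
  qed
  moreover have "t ^ 3 / (3 * X\<^sup>2) \<le> 1 / 2"
  proof -
    have "t ^ 3 \<le> 2 ^ 3" using assms by (intro power_mono) auto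
    moreover have "64\<^sup>2 \<le> X\<^sup>2" using X(1) by (intro power_mono) auto
    ultimately show ?thesis using X(1) by (simp add: field_simps)
  qed
  ultimately show ?thesis by simp
qed

lemma \<beta>0: "1 / 2 + \<kappa> * (2 * X / 3 - 1) \<le> \<beta>\<^sub>0"
proof -
  have "2 * X / 3 - 1 \<le> (X + (- x\<^sub>0 - X)) - (X + (- x\<^sub>0 - X)) ^ 3 / (3 * X\<^sup>2)"
    using x0 by (intro cubic_near) (auto simp: L_def)
  also have "\<dots> = - (x\<^sub>0 - x\<^sub>0 ^ 3 / (3 * X\<^sup>2))" by simp
  finally have "\<kappa> * (2 * X / 3 - 1) \<le> \<kappa> * - (x\<^sub>0 - x\<^sub>0 ^ 3 / (3 * X\<^sup>2))"
    using \<kappa> by (intro mult_left_mono) auto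
  then show ?thesis unfolding \<beta>\<^sub>0_def by (simp only: mult_minus_right)
qed

text \<open>\<open>w\<close> is affine in the parameter, so lower bounds need checking only at 0 and
  1.\<close>

lemma w_interpolate: "Re (w (of_real s) \<xi>) = (1 - s) * Re (w 0 \<xi>) + s * Re (w 1 \<xi>)"
proof -
  note e = Re_w[of 0 \<xi>, unfolded of_real_0] Re_w[of 1 \<xi>, unfolded of_real_1]
  define c where "c = (Re \<xi> ^ 3 - 3 * Re \<xi> * (Im \<xi>)\<^sup>2) / (3 * X\<^sup>2)"
  show ?thesis unfolding e Re_w c_def[symmetric] by (simp add: algebra_simps)
qed

lemma interpolate_lower:
  assumes "0 \<le> s" "s \<le> 1" "l \<le> Re (w 0 \<xi>)" "l \<le> Re (w 1 \<xi>)"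
  shows "l \<le> Re (w (of_real s) \<xi>)"
proof -
  have "(1 - s) * l + s * l \<le> (1 - s) * Re (w 0 \<xi>) + s * Re (w 1 \<xi>)"
    using assms by (intro add_mono mult_left_mono) auto
  then show ?thesis by (simp add: w_interpolate algebra_simps)
qed

lemma width: "L \<le> 2 * X" using X(1) by (simp add: L_def)

text \<open>The two terms are at most \<open>2 * X\<close> and \<open>8 * X / 3\<close>. This
  explains the summand \<open>5 * \<kappa> * X\<close> in \<open>\<beta>\<^sub>1\<close>.\<close>

lemma cube_bounds:
  assumes "\<bar>x\<bar> \<le> L" shows "\<bar>x + x ^ 3 / (3 * X\<^sup>2)\<bar> \<le> 5 * X"
proof -
  have x: "\<bar>x\<bar> \<le> 2 * X" using assms width by simp
  have "\<bar>x ^ 3\<bar> \<le> (2 * X) ^ 3" unfolding power_abs by (rule power_mono[OF x]) simp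
  also have "\<dots> = 8 * X / 3 * (3 * X\<^sup>2)" by (simp add: power2_eq_square power3_eq_cube)
  finally have "\<bar>x ^ 3 / (3 * X\<^sup>2)\<bar> \<le> 8 * X / 3" using X(1) by (simp add: abs_divide pos_divide_le_eq)
  then show ?thesis using x X(1) by linarith
qed

text \<open>This is the mixed term of the real part of the cube, which measures the deviation from
  the real axis; it is at most \<open>32 / X\<close>.\<close>

lemma shift_bound:
  assumes "\<bar>x\<bar> \<le> L" "y\<^sup>2 \<le> 16" shows "\<bar>x * y\<^sup>2 / X\<^sup>2\<bar> \<le> 1 / 2"
proof -
  have "\<bar>x * y\<^sup>2\<bar> \<le> 2 * X * 16"
    unfolding abs_mult using assms width by (intro mult_mono) auto
  also have "\<dots> \<le> X\<^sup>2 / 2" using X(1) by (simp add: power2_eq_square)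
  finally show ?thesis using X(1) by (simp add: abs_divide pos_divide_le_eq)
qed

lemma Re_w0:
  assumes "\<bar>Re \<xi>\<bar> \<le> L" "(Im \<xi>)\<^sup>2 \<le> 16"
  shows "B + 1 - \<kappa> * \<bar>Re \<xi> * (Im \<xi>)\<^sup>2 / X\<^sup>2\<bar> \<le> Re (w 0 \<xi>)"
proof -
  have "Re (w 0 \<xi>) = B + 1 + \<kappa> * (5 * X - (Re \<xi> + Re \<xi> ^ 3 / (3 * X\<^sup>2)) + Re \<xi> * (Im \<xi>)\<^sup>2 / X\<^sup>2)"
    using Re_w[of 0 \<xi>] X(1) by (simp add: \<beta>\<^sub>1_def field_simps)
  moreover have "- \<bar>Re \<xi> * (Im \<xi>)\<^sup>2 / X\<^sup>2\<bar> \<le> 5 * X - (Re \<xi> + Re \<xi> ^ 3 / (3 * X\<^sup>2)) + Re \<xi> * (Im \<xi>)\<^sup>2 / X\<^sup>2"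
    using cube_bounds[OF assms(1)] by linarith
  then have "\<kappa> * - \<bar>Re \<xi> * (Im \<xi>)\<^sup>2 / X\<^sup>2\<bar> \<le> \<kappa> * (5 * X - (Re \<xi> + Re \<xi> ^ 3 / (3 * X\<^sup>2)) + Re \<xi> * (Im \<xi>)\<^sup>2 / X\<^sup>2)"
    using \<kappa> by (intro mult_left_mono) auto
  ultimately show ?thesis by simp
qed

lemma Re_w1: "Re (w 1 \<xi>) = \<beta>\<^sub>0 + \<kappa> * ((Re \<xi> - Re \<xi> ^ 3 / (3 * X\<^sup>2)) + Re \<xi> * (Im \<xi>)\<^sup>2 / X\<^sup>2)"
  using Re_w[of 1 \<xi>] X(1) by (simp add: field_simps)

lemma Re_w1_lower:
  assumes "\<bar>Re \<xi>\<bar> \<le> L" "(Im \<xi>)\<^sup>2 \<le> 16"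
  shows "7 / 16 \<le> Re (w 1 \<xi>)"
proof -
  \<comment> \<open>The \<open>2 * X / 3\<close> contained in \<open>\<beta>\<^sub>0\<close> cancels
    the minimum of the cubic. At most \<open>2 * \<kappa>\<close>, hence 1/32, is lost from
    1/2.\<close>
  have "- 2 \<le> 2 * X / 3 - 1 + ((Re \<xi> - Re \<xi> ^ 3 / (3 * X\<^sup>2)) + Re \<xi> * (Im \<xi>)\<^sup>2 / X\<^sup>2)"
    using cubic_lower[of "Re \<xi>"] shift_bound[OF assms] assms(1) width by linarith
  then have "\<kappa> * - 2 \<le> \<kappa> * (2 * X / 3 - 1 + ((Re \<xi> - Re \<xi> ^ 3 / (3 * X\<^sup>2)) + Re \<xi> * (Im \<xi>)\<^sup>2 / X\<^sup>2))"
    using \<kappa> by (intro mult_left_mono) auto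
  then show ?thesis
    using \<beta>0 \<kappa>(2) unfolding Re_w1 by (simp only: distrib_left)
qed

lemma v_x0: "v 1 (of_real x\<^sub>0) = 1"
proof -
  have *: "w 1 (of_real x\<^sub>0) = 1 / 2"
    using Re_w1[of "of_real x\<^sub>0"] Im_w[of 1 "of_real x\<^sub>0"] by (simp add: complex_eq_iff \<beta>\<^sub>0_def)
  show ?thesis unfolding v_def u_x0 * by simp
qed

text \<open>Here \<open>u\<close> is real and at least 8, so the pole term takes at most 1/16 from
  the real part 7/16 and adds no imaginary part; that of \<open>w\<close> carries the factor
  \<open>\<kappa>\<close>.\<close>

lemma cut:
  assumes "\<bar>Im \<xi>\<bar> = pi" "\<bar>Re \<xi>\<bar> \<le> L" "0 \<le> s" "s \<le> 1"
  shows "Im (u \<xi>) = 0" "2 * A \<le> Re (u \<xi>)" "1 / 4 \<le> Re (v (of_real s) \<xi>)"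
    "\<bar>Im (v (of_real s) \<xi>)\<bar> \<le> 24 * \<kappa>"
proof -
  have "Im \<xi> = pi \<or> Im \<xi> = - pi" using assms(1) by linarith
  then have pi: "sin (Im \<xi>) = 0" "cos (Im \<xi>) = -1" "(Im \<xi>)\<^sup>2 = pi\<^sup>2" by auto
  show Imu: "Im (u \<xi>) = 0" by (simp add: Im_u pi)
  show Reu: "2 * A \<le> Re (u \<xi>)" using exp_ge[of "Re \<xi>"] assms(2) \<delta> pi by (simp add: Re_u abs_le_iff)
  have b: "(Im \<xi>)\<^sup>2 \<le> 16" using pi2 pi by simp
  have "7 / 16 \<le> Re (w 0 \<xi>)"
  proof -
    have "\<kappa> * \<bar>Re \<xi> * (Im \<xi>)\<^sup>2 / X\<^sup>2\<bar> \<le> 1 * (1 / 2)"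
      using \<kappa> shift_bound[OF assms(2) b] by (intro mult_mono) auto
    then show ?thesis using Re_w0[OF assms(2) b] B by linarith
  qed
  then have "7 / 16 \<le> Re (w (of_real s) \<xi>)"
    using interpolate_lower assms(3,4) Re_w1_lower[OF assms(2) b] by blast
  moreover have "1 / (2 * Re (u \<xi>)) \<le> 1 / (2 * 8)"
    using Reu A by (intro divide_left_mono) auto
  ultimately show "1 / 4 \<le> Re (v (of_real s) \<xi>)"
    by (simp add: Re_v_real[OF Imu])
  have Imv: "Im (v (of_real s) \<xi>) = \<kappa> * Im \<xi> * ((2 * s - 1) - (3 * (Re \<xi>)\<^sup>2 - (Im \<xi>)\<^sup>2) / (3 * X\<^sup>2))"
    by (simp add: Im_v Imu Im_w)
  \<comment> \<open>The three contributions are at most 1, 4 and 1. Together with \<pi> < 4 this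
    gives the constant 24.\<close>
  have K: "\<bar>(2 * s - 1) - (3 * (Re \<xi>)\<^sup>2 - (Im \<xi>)\<^sup>2) / (3 * X\<^sup>2)\<bar> \<le> 6"
  proof -
    have "(Re \<xi>)\<^sup>2 \<le> (2 * X)\<^sup>2" using assms(2) width by (intro abs_le_square_iff[THEN iffD1]) auto
    then have "(Re \<xi>)\<^sup>2 / X\<^sup>2 \<le> 4" using X(1) by (simp add: pos_divide_le_eq)
    moreover have "(Im \<xi>)\<^sup>2 / (3 * X\<^sup>2) \<le> 1"
    proof -
      have "64\<^sup>2 \<le> X\<^sup>2" using X(1) by (intro power_mono) auto
      then show ?thesis using b X(1) by (simp add: pos_divide_le_eq)
    qed
    moreover have "(3 * (Re \<xi>)\<^sup>2 - (Im \<xi>)\<^sup>2) / (3 * X\<^sup>2) = (Re \<xi>)\<^sup>2 / X\<^sup>2 - (Im \<xi>)\<^sup>2 / (3 * X\<^sup>2)"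
      by (simp add: diff_divide_distrib)
    moreover have "0 \<le> (Re \<xi>)\<^sup>2 / X\<^sup>2" "0 \<le> (Im \<xi>)\<^sup>2 / (3 * X\<^sup>2)" by simp_all
    ultimately show ?thesis using assms(3,4) unfolding abs_le_iff by linarith
  qed
  have "\<bar>\<kappa> * Im \<xi>\<bar> \<le> \<kappa> * 4"
    using \<kappa> assms(1) pi_less_4 by (simp add: abs_mult)
  then show "\<bar>Im (v (of_real s) \<xi>)\<bar> \<le> 24 * \<kappa>"
    using mult_mono[OF _ K, of "\<bar>\<kappa> * Im \<xi>\<bar>" "\<kappa> * 4"] \<kappa>
    unfolding Imv abs_mult[of "\<kappa> * Im \<xi>"] by simp
qed

lemma real_axis:
  assumes "Im \<xi> = 0" "\<bar>Re \<xi>\<bar> \<le> L"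
  shows "Im (u \<xi>) = 0" "Re (u \<xi>) \<le> - \<delta>" "Im (v (of_real s) \<xi>) = 0" "B + 1 \<le> Re (w 0 \<xi>)"
    "Re (w (of_real s) \<xi>) < Re (v (of_real s) \<xi>)"
proof -
  show Imu: "Im (u \<xi>) = 0" by (simp add: Im_u assms)
  show Reu: "Re (u \<xi>) \<le> - \<delta>" using exp_ge[of "Re \<xi>"] assms by (simp add: Re_u abs_le_iff)
  show "Im (v (of_real s) \<xi>) = 0" by (simp add: Im_v Imu Im_w assms)
  show "B + 1 \<le> Re (w 0 \<xi>)" using Re_w0[of \<xi>] assms by simp
  have "1 / (2 * Re (u \<xi>)) < 0" using Reu \<delta> by (intro divide_pos_neg) auto
  then show "Re (w (of_real s) \<xi>) < Re (v (of_real s) \<xi>)"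
    by (simp add: Re_v_real[OF Imu])
qed

text \<open>The height \<open>2 * X / 3 - 1\<close> counts twice: in \<open>\<beta>\<^sub>0\<close>,
  which compensates the low value of the cubic at \<open>x\<^sub>0\<close>, and as the value at
  \<open>L\<close>. The sum is at least \<open>X\<close>, and
  \<open>\<kappa> * X = B\<close>.\<close>

lemma right_end:
  assumes "0 \<le> s" "s \<le> 1"
  shows "B < Re (v (of_real s) (of_real L))"
proof -
  have L: "\<bar>Re (of_real L)\<bar> \<le> L" using X(1) by (simp add: L_def)
  have "2 * X / 3 - 1 \<le> L - L ^ 3 / (3 * X\<^sup>2)"
    using cubic_near[of 2] by (simp add: L_def)
  then have "X \<le> 2 * X / 3 - 1 + (L - L ^ 3 / (3 * X\<^sup>2))" using X(1) by linarith
  then have "\<kappa> * X \<le> \<kappa> * (2 * X / 3 - 1 + (L - L ^ 3 / (3 * X\<^sup>2)))"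
    using \<kappa> by (intro mult_left_mono) auto
  then have "B \<le> Re (w 1 (of_real L))"
    using \<beta>0 X(2) by (simp add: Re_w1 distrib_left)
  moreover have "B \<le> Re (w 0 (of_real L))" using real_axis(4)[OF _ L] by simp
  ultimately have "B \<le> Re (w (of_real s) (of_real L))" using interpolate_lower assms by blast
  then show ?thesis using real_axis(5)[OF _ L, of s] by simp
qed

text \<open>The cubic yields only a nonnegative \<open>w\<close> here; the pole term supplies
  \<open>2 * B\<close>.\<close>

lemma left_end:
  assumes "0 \<le> s" "s \<le> 1"
  shows "B < Re (v (of_real s) (of_real (- L)))"
proof -
  have L: "\<bar>Re (of_real (- L))\<bar> \<le> L" using X(1) by (simp add: L_def)
  have "0 \<le> Re (w 0 (of_real (- L)))" using real_axis(4)[OF _ L] B by simp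
  moreover have "0 \<le> Re (w 1 (of_real (- L)))" using Re_w1_lower[OF L] by simp
  ultimately have "0 \<le> Re (w (of_real s) (of_real (- L)))" using interpolate_lower assms by blast
  moreover have "Re (u (of_real (- L))) = - \<delta>" by (simp add: Re_u)
  moreover have "Im (u (of_real (- L))) = 0" by (simp add: Im_u)
  ultimately show ?thesis using \<delta> B by (simp add: Re_v_real)
qed

text \<open>Beyond the turning points the cubic decreases even for \<open>s = 1\<close>; the gain
  \<open>6 * X + 3\<close> from the distance 1 absorbs \<open>y\<^sup>2\<close>.\<close>

lemma far:
  assumes "X + 1 \<le> \<bar>x\<bar>" "y\<^sup>2 \<le> 16" "s \<le> 1"
  shows "3 * X\<^sup>2 * (2 * s - 1) < 3 * x\<^sup>2 - y\<^sup>2"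
proof -
  have "3 * X\<^sup>2 * (2 * s - 1) \<le> 3 * X\<^sup>2 * 1" using assms(3) by (intro mult_left_mono) auto
  moreover have "(X + 1)\<^sup>2 \<le> x\<^sup>2"
    using assms(1) X(1) by (intro abs_le_square_iff[THEN iffD1]) auto
  moreover have "3 * (X + 1)\<^sup>2 = 3 * X\<^sup>2 + 6 * X + 3" by (simp add: power2_eq_square algebra_simps)
  ultimately show ?thesis using assms(2) X(1) by linarith
qed

end

section \<open>Extension near the spacelike points\<close>

context null_pair
begin

lemma pt_diff: "pt a b - pt c d = pt (a - c) (b - d)"
  using cscale_add_left[of "a - c" c "cpx p"] cscale_add_left[of "b - d" d "cpx q"]
  by (simp add: pt_def)

lemma im_pt_pt: "im_pt (pt a b) = Im a *\<^sub>R p + Im b *\<^sub>R q"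
  by (simp add: pt_def im_pt_add im_pt_cscale_cpx)

lemma comb_cone:
  assumes "0 \<le> s" "0 \<le> t"
  shows "norm (snd (s *\<^sub>R p + t *\<^sub>R q)) \<le> fst (s *\<^sub>R p + t *\<^sub>R q)"
  using norm_triangle_ineq[of "s *\<^sub>R snd p" "t *\<^sub>R snd q"] assms null by simp

lemma pt_add_Tplus:
  assumes "z \<in> Tplus" "0 \<le> Im a" "0 \<le> Im b"
  shows "pt a b + z \<in> Tplus"
  using Vplus_add[OF _ comb_cone[OF assms(2,3)], of "im_pt z"] assms(1)
  by (simp add: Tplus_def im_pt_add im_pt_pt add.commute)

lemma pt_add_Tminus:
  assumes "z \<in> Tminus" "Im a \<le> 0" "Im b \<le> 0"
  shows "pt a b + z \<in> Tminus"
proof -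
  have "- im_pt z + ((- Im a) *\<^sub>R p + (- Im b) *\<^sub>R q) \<in> Vplus"
    using assms by (intro Vplus_add comb_cone) (auto simp: Tminus_def Vminus_iff)
  also have "- im_pt z + ((- Im a) *\<^sub>R p + (- Im b) *\<^sub>R q) = - im_pt (pt a b + z)"
    by (simp add: im_pt_add im_pt_pt)
  finally show ?thesis by (simp add: Tminus_def Vminus_iff)
qed

lemma holo_curve_at_pt:
  assumes "a field_differentiable at t" "b field_differentiable at t"
  shows "holo_curve_at (\<lambda>t. pt (a t) (b t)) t"
proof -
  obtain a' b' where "(a has_field_derivative a') (at t)" "(b has_field_derivative b') (at t)"
    using assms unfolding field_differentiable_def by blast
  then show ?thesis
    unfolding pt_def by (intro holo_curve_at_add holo_curve_at_cscale)
qed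

lemma continuous_on_pt:
  assumes "continuous_on S a" "continuous_on S b"
  shows "continuous_on S (\<lambda>x. pt (a x) (b x))"
  unfolding pt_def
  by (intro continuous_on_add bounded_linear.continuous_on[OF bounded_linear_cscale_left] assms)

text \<open>The extension is the value of \<open>G\<close> at the parameter whose image for
  \<open>\<sigma> = 1\<close> is the spacelike point. Agreement with \<open>f\<close> is needed in
  the tubes only; the identity theorem spreads it later.\<close>

lemma local_extension:
  fixes \<mu> :: real and s :: "'m rpt"
  defines "\<Omega> \<equiv> tilde (Vmu \<mu>) \<union> tilde (ccompl (Dcone 0 s)) \<union> Tplus \<union> Tminus"
  assumes s: "s \<in> Vplus" and f: "holo_on f \<Omega>" "open \<Omega>"
  obtains r h where "0 < r" "holo_on h (ball (cpx (q - p)) r)"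
    "\<And>z. z \<in> ball (cpx (q - p)) r \<Longrightarrow> z \<in> Tplus \<union> Tminus \<Longrightarrow> h z = f z"
proof -
  define m where "m = mink p q"
  have m: "0 < m" using pos by (simp add: m_def)
  obtain c where "0 < c" and c: "\<And>\<mu> u v. 1/4 \<le> u \<Longrightarrow> 1/4 \<le> Re v \<Longrightarrow> \<bar>Im v\<bar> < c \<Longrightarrow>
      2 * \<mu>\<^sup>2 < mink p q * u * Re v \<Longrightarrow> pt (of_real u) v \<in> tilde (Vmu \<mu>)"
    using pt_tilde_Vmu by blast
  \<comment> \<open>With these choices \<open>v\<close> above \<open>B\<close> meets the condition
    of \<open>pt_tilde_Dcone\<close>, \<open>24 * \<kappa>\<close> is at most \<open>c / 2\<close>,
    and \<open>m * (2 * A) * (1 / 4)\<close> exceeds \<open>2 * \<mu>\<^sup>2\<close>.\<close>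
  define B where "B = max 1 (mink s p / m)"
  define \<kappa> where "\<kappa> = min (1 / 64) (c / 48)"
  define A where "A = 4 + 4 * \<mu>\<^sup>2 / m"
  interpret disc_family B \<kappa> A
    by unfold_locales (use m \<open>0 < c\<close> in \<open>auto simp: B_def \<kappa>_def A_def\<close>)
  define a b where "a = Complex (- L) (- pi)" and "b = Complex L pi"
  define D where "D = {\<xi>. u \<xi> \<noteq> 0}"
  define \<phi> where "\<phi> \<sigma> \<xi> = pt (u \<xi>) (v \<sigma> \<xi>)" for \<sigma> \<xi>
  have L0: "0 < L" using X(1) by (simp add: L_def)
  have cbox: "\<bar>Re \<xi>\<bar> \<le> L" "- L \<le> Re \<xi>" "\<bar>Im \<xi>\<bar> \<le> pi" "(Im \<xi>)\<^sup>2 \<le> 16" if "\<xi> \<in> cbox a b" for \<xi>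
  proof -
    show "\<bar>Re \<xi>\<bar> \<le> L" "- L \<le> Re \<xi>" and *: "\<bar>Im \<xi>\<bar> \<le> pi"
      using that by (auto simp: a_def b_def in_cbox_complex_iff)
    then show "(Im \<xi>)\<^sup>2 \<le> 16"
      using pi2 abs_le_square_iff[of "Im \<xi>" pi] by simp
  qed
  have in_T: "\<phi> (of_real t) \<xi> \<in> \<Omega>"
    if "\<xi> \<in> cbox a b" "3 * X\<^sup>2 * (2 * t - 1) < 3 * (Re \<xi>)\<^sup>2 - (Im \<xi>)\<^sup>2" "Im \<xi> \<noteq> 0" "\<bar>Im \<xi>\<bar> < pi" for t \<xi>
  proof (cases "Im \<xi> < 0")
    case True
    with timelike(1)[OF cbox(2)[OF that(1)] that(2) _ that(4)] that(3) show ?thesis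
      by (simp add: \<phi>_def \<Omega>_def pt_Tplus)
  next
    case False
    with timelike(2)[OF cbox(2)[OF that(1)] that(2) _ that(4)] that(3) show ?thesis
      by (simp add: \<phi>_def \<Omega>_def pt_Tminus)
  qed
  have in_cut: "\<phi> (of_real t) \<xi> \<in> \<Omega>" if "\<xi> \<in> cbox a b" "\<bar>Im \<xi>\<bar> = pi" "0 \<le> t" "t \<le> 1" for t \<xi>
  proof -
    note k = cut[OF that(2) cbox(1)[OF that(1)] that(3,4)]
    have "pt (of_real (Re (u \<xi>))) (v (of_real t) \<xi>) \<in> tilde (Vmu \<mu>)"
    proof (rule c)
      show "1 / 4 \<le> Re (u \<xi>)" using k(2) A by simp
      show "\<bar>Im (v (of_real t) \<xi>)\<bar> < c" using k(4) \<open>0 < c\<close> by (simp add: \<kappa>_def)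
      have "2 * \<mu>\<^sup>2 < m * (2 * A) * (1 / 4)" using m by (simp add: A_def field_simps)
      also have "\<dots> \<le> m * Re (u \<xi>) * Re (v (of_real t) \<xi>)"
        using m k A by (intro mult_mono) auto
      finally show "2 * \<mu>\<^sup>2 < mink p q * Re (u \<xi>) * Re (v (of_real t) \<xi>)" by (simp add: m_def)
    qed (use k in auto)
    moreover have "of_real (Re (u \<xi>)) = u \<xi>" using k(1) by (simp add: complex_eq_iff)
    ultimately show ?thesis by (simp add: \<phi>_def \<Omega>_def)
  qed
  have in_real: "\<phi> (of_real t) \<xi> \<in> \<Omega>"
    if "\<xi> \<in> cbox a b" "Im \<xi> = 0" "B < Re (v (of_real t) \<xi>)" for t \<xi>
  proof -
    note k = real_axis[OF that(2) cbox(1)[OF that(1)]]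
    have "mink s p < Re (v (of_real t) \<xi>) * m"
      using that(3) m by (simp add: B_def pos_divide_less_eq)
    then have "pt (of_real (Re (u \<xi>))) (of_real (Re (v (of_real t) \<xi>))) \<in> \<Omega>"
      using s k(2) \<delta>(1) pt_tilde_Dcone by (simp add: \<Omega>_def m_def)
    moreover have "of_real (Re (u \<xi>)) = u \<xi>" "of_real (Re (v (of_real t) \<xi>)) = v (of_real t) \<xi>"
      using k(1) k(3)[of t] by (simp_all add: complex_eq_iff)
    ultimately show ?thesis by (simp add: \<phi>_def)
  qed
  have seg01: "\<exists>t. \<sigma> = of_real t \<and> 0 \<le> t \<and> t \<le> 1" if "\<sigma> \<in> closed_segment 0 1" for \<sigma> :: complex
    using that by (auto simp: in_segment scaleR_conv_of_real)
  \<comment> \<open>Over \<open>x\<^sub>0\<close> every nonreal point lies in a tube for all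
    parameters in [0, 1]. One segment is taken on each side of the real axis, since the two tubes
    are compared with \<open>f\<close> separately.\<close>
  define K where "K = closed_segment (Complex x\<^sub>0 1) (Complex x\<^sub>0 3) \<union>
    closed_segment (Complex x\<^sub>0 (-1)) (Complex x\<^sub>0 (-3))"
  have pi3: "3 < pi" using pi_gt3 .
  have K: "Re \<xi> = x\<^sub>0" "Im \<xi> \<noteq> 0" "\<bar>Im \<xi>\<bar> < pi" if "\<xi> \<in> K" for \<xi>
    using that pi3 by (auto simp: K_def closed_segment_same_Re closed_segment_eq_real_ivl)
  have x0': "- L < x\<^sub>0" "x\<^sub>0 < L" "X + 1 \<le> \<bar>x\<^sub>0\<bar>" using x0 L0 X(1) by auto
  have Kbox: "K \<subseteq> box a b"
  proof
    fix \<xi> assume "\<xi> \<in> K"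
    from K[OF this] x0' show "\<xi> \<in> box a b"
      by (simp add: a_def b_def in_box_complex_iff abs_less_iff)
  qed
  have "open D"
    unfolding D_def u_def by (intro open_Collect_neq continuous_intros)
  have sub: "cbox a b \<subseteq> D" using u_nonzero cbox(2) by (auto simp: D_def)
  have box_cbox: "box a b \<subseteq> cbox a b" by (rule box_subset_cbox)
  have contu: "continuous_on T u" for T unfolding u_def by (intro continuous_intros)
  have contv: "continuous_on (UNIV \<times> D) (\<lambda>x. v (fst x) (snd x))"
    unfolding v_def w_def using X(1)
    by (intro continuous_intros continuous_on_compose2[OF contu[of UNIV]]) (auto simp: D_def)
  have derivu: "u field_differentiable at \<xi>" for \<xi>
    unfolding u_def by (intro derivative_intros) (auto intro!: field_differentiable_within_exp)
  have derivv: "v \<sigma> field_differentiable at \<xi>" if "\<xi> \<in> D" for \<sigma> \<xi>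
    unfolding v_def w_def using that X(1) derivu
    by (intro derivative_intros) (auto simp: D_def)
  have ab: "Re a < Re b" "Im a < Im b" using L0 by (auto simp: a_def b_def)
  \<comment> \<open>The horizontal edges use \<open>Vmu\<close>, the real points of the vertical
    edges the causal complement, and all remaining boundary points the tubes.\<close>
  have bdry: "\<phi> \<sigma> \<xi> \<in> \<Omega>" if hyp: "\<sigma> \<in> closed_segment 0 1" "\<xi> \<in> path_image (rectpath a b)" for \<sigma> \<xi>
  proof -
    obtain t where t: "\<sigma> = of_real t" "0 \<le> t" "t \<le> 1" using seg01[OF hyp(1)] by blast
    have \<xi>: "\<xi> \<in> cbox a b" using hyp(2) ab path_image_rectpath_subset_cbox[of a b] by auto
    have disj: "(Re \<xi> = L \<or> Re \<xi> = - L) \<or> \<bar>Im \<xi>\<bar> = pi"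
      using hyp(2) ab L0 by (auto simp: path_image_rectpath a_def b_def)
    show ?thesis
    proof (cases "\<bar>Im \<xi>\<bar> = pi")
      case True
      then show ?thesis using in_cut \<xi> t by blast
    next
      case False
      then have Re: "Re \<xi> = L \<or> Re \<xi> = - L" using disj by blast
      show ?thesis
      proof (cases "Im \<xi> = 0")
        case True
        then have "\<xi> = of_real L \<or> \<xi> = of_real (- L)" using Re by (auto simp: complex_eq_iff)
        then have "B < Re (v (of_real t) \<xi>)" using right_end left_end t by blast
        then show ?thesis using in_real[OF \<xi> True] t by simp
      next
        case Im: False
        have "X + 1 \<le> \<bar>Re \<xi>\<bar>" using Re X(1) by (auto simp: L_def)
        then show ?thesis
          using in_T[OF \<xi> far[OF _ cbox(4)[OF \<xi>] t(3)] Im] cbox(3)[OF \<xi>] False t(1) by simp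
      qed
    qed
  qed
  have init: "\<phi> 0 \<xi> \<in> \<Omega>" if \<xi>: "\<xi> \<in> cbox a b" for \<xi>
  proof -
    consider "\<bar>Im \<xi>\<bar> = pi" | "Im \<xi> = 0" | "Im \<xi> \<noteq> 0" "\<bar>Im \<xi>\<bar> < pi"
      using cbox(3)[OF \<xi>] by fastforce
    then show ?thesis
    proof cases
      case 1
      then show ?thesis using in_cut[OF \<xi>, of 0] by simp
    next
      case 2
      have "B < Re (v (of_real 0) \<xi>)"
        using real_axis(4)[OF 2 cbox(1)[OF \<xi>]] real_axis(5)[OF 2 cbox(1)[OF \<xi>], of 0] by simp
      then show ?thesis using in_real[OF \<xi> 2, of 0] by simp
    next
      case 3
      \<comment> \<open>For parameter 0 the condition of \<open>timelike\<close> holds on the whole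
        rectangle, since \<open>3 * X\<^sup>2\<close> outweighs
        \<open>(Im \<xi>)\<^sup>2\<close>.\<close>
      have "4096 \<le> X\<^sup>2" using power_mono[of 64 X 2] X(1) by simp
      then have "- (3 * X\<^sup>2) < 3 * (Re \<xi>)\<^sup>2 - (Im \<xi>)\<^sup>2"
        using cbox(4)[OF \<xi>] zero_le_power2[of "Re \<xi>"] by linarith
      then show ?thesis using in_T[OF \<xi> _ 3, of 0] by simp
    qed
  qed
  have inK: "\<phi> \<sigma> \<xi> \<in> \<Omega>" if hyp: "\<sigma> \<in> closed_segment 0 1" "\<xi> \<in> K" for \<sigma> \<xi>
  proof -
    obtain t where t: "\<sigma> = of_real t" "0 \<le> t" "t \<le> 1" using seg01[OF hyp(1)] by blast
    have \<xi>: "\<xi> \<in> cbox a b" using hyp(2) Kbox box_cbox by blast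
    show ?thesis
      using in_T[OF \<xi> far[OF _ cbox(4)[OF \<xi>] t(3)]] K[OF hyp(2)] x0'(3) t(1) by simp
  qed
  obtain r G where "0 < r"
    and G1: "\<And>\<xi>. \<xi> \<in> box a b \<Longrightarrow> holo_on (G \<xi>) (ball 0 r)"
    and G2: "\<And>z. z \<in> ball 0 r \<Longrightarrow> (\<lambda>\<xi>. G \<xi> z) holomorphic_on box a b"
    and G3: "\<And>\<xi> z. \<xi> \<in> K \<Longrightarrow> z \<in> ball 0 r \<Longrightarrow> G \<xi> z = f (\<phi> 1 \<xi> + z)"
  proof (rule rectangle_continuation[OF f \<open>open D\<close> sub, where \<phi> = \<phi> and K = K])
    show "continuous_on (UNIV \<times> D) (\<lambda>(\<sigma>, \<xi>). \<phi> \<sigma> \<xi>)"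
      unfolding \<phi>_def case_prod_unfold
      by (intro continuous_on_pt contv continuous_on_compose2[OF contu[of UNIV]] continuous_intros) auto
    show "holo_curve_at (\<lambda>\<sigma>. \<phi> \<sigma> \<xi>) \<sigma>" if "\<xi> \<in> D" for \<sigma> \<xi>
      unfolding \<phi>_def
    proof (rule holo_curve_at_pt)
      show "(\<lambda>\<sigma>. v \<sigma> \<xi>) field_differentiable at \<sigma>"
        unfolding v_def w_def by (intro derivative_intros)
    qed (intro derivative_intros)
    show "holo_curve_at (\<phi> \<sigma>) \<xi>" if "\<xi> \<in> D" for \<sigma> \<xi>
      unfolding \<phi>_def[abs_def] by (intro holo_curve_at_pt derivu derivv[OF that])
    show "compact K" by (auto simp: K_def)
  qed (use ab init bdry Kbox inK that in \<open>auto\<close>)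
  define \<xi>\<^sub>0 where "\<xi>\<^sub>0 = complex_of_real x\<^sub>0"
  have \<xi>0: "\<xi>\<^sub>0 \<in> box a b" using x0' pi3 by (simp add: \<xi>\<^sub>0_def a_def b_def in_box_complex_iff)
  have centre: "\<phi> 1 \<xi>\<^sub>0 = pt (- 1) 1" "cpx (q - p) = pt (- 1) 1"
    using pt_of_real[of "- 1" 1] by (simp_all add: \<phi>_def \<xi>\<^sub>0_def u_x0 v_x0)
  define h where "h z = G \<xi>\<^sub>0 (z - cpx (q - p))" for z
  \<comment> \<open>\<open>G\<close> equals \<open>f\<close> on a segment of \<open>K\<close>, and
    the identity theorem in \<open>\<xi>\<close> carries this along a vertical path to
    \<open>\<xi>\<^sub>0\<close>. The set \<open>S\<close> may be disconnected, so its component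
    containing the path is used.\<close>
  have agree: "h z = f z"
    if z: "z \<in> ball (cpx (q - p)) r" and t: "t = 1 \<or> t = -1"
      and path: "\<And>\<xi>. \<xi> \<in> closed_segment \<xi>\<^sub>0 (Complex x\<^sub>0 (3 * t)) \<Longrightarrow> \<phi> 1 \<xi> + (z - cpx (q - p)) \<in> \<Omega>"
    for z t
  proof -
    define z' where "z' = z - cpx (q - p)"
    have z': "z' \<in> ball 0 r" using z by (simp add: z'_def dist_norm norm_minus_commute)
    define S where "S = {\<xi> \<in> box a b. \<phi> 1 \<xi> + z' \<in> \<Omega>}"
    have hc: "holo_curve_at (\<lambda>\<xi>. \<phi> 1 \<xi> + z') \<xi>" if "\<xi> \<in> box a b" for \<xi>
      unfolding \<phi>_def using that box_cbox sub
      by (intro holo_curve_at_add_const holo_curve_at_pt derivu derivv) auto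
    have "continuous_on (box a b) (\<lambda>\<xi>. \<phi> 1 \<xi> + z')"
      by (intro continuous_at_imp_continuous_on ballI)
         (use hc in \<open>auto simp: holo_curve_at_def intro: has_derivative_continuous simp del: split_paired_Ex\<close>)
    then have "open S"
      using continuous_open_preimage[OF _ open_box f(2)] by (simp add: S_def vimage_def Int_def)
    let ?s = "closed_segment \<xi>\<^sub>0 (Complex x\<^sub>0 (3 * t))"
    let ?k = "closed_segment (Complex x\<^sub>0 t) (Complex x\<^sub>0 (3 * t))"
    let ?C = "connected_component_set S \<xi>\<^sub>0"
    have s_box: "?s \<subseteq> box a b"
      using t x0' pi3 by (auto simp: \<xi>\<^sub>0_def a_def b_def in_box_complex_iff closed_segment_same_Re closed_segment_eq_real_ivl)
    have "?s \<subseteq> S" using path s_box by (auto simp: S_def z'_def)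
    then have "?s \<subseteq> ?C" by (intro connected_component_maximal) auto
    moreover have "?k \<subseteq> ?s"
      using t by (auto simp: \<xi>\<^sub>0_def closed_segment_same_Re closed_segment_eq_real_ivl)
    ultimately have kC: "?k \<subseteq> ?C" by blast
    have kK: "?k \<subseteq> K" using t by (auto simp: K_def)
    have CS: "?C \<subseteq> S" by (rule connected_component_subset)
    have "G \<xi>\<^sub>0 z' - f (\<phi> 1 \<xi>\<^sub>0 + z') = 0"
    proof (rule analytic_continuation[where S = ?C and U = ?k and w = \<xi>\<^sub>0
          and f = "\<lambda>\<xi>. G \<xi> z' - f (\<phi> 1 \<xi> + z')" and \<xi> = "Complex x\<^sub>0 t"])
      show "(\<lambda>\<xi>. G \<xi> z' - f (\<phi> 1 \<xi> + z')) holomorphic_on ?C"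
      proof (rule holomorphic_on_subset[OF _ CS], rule holomorphic_on_diff)
        show "(\<lambda>\<xi>. G \<xi> z') holomorphic_on S"
          using G2[OF z'] by (rule holomorphic_on_subset) (auto simp: S_def)
        show "(\<lambda>\<xi>. f (\<phi> 1 \<xi> + z')) holomorphic_on S"
          by (rule holomorphic_on_holo_on_curve[OF f(1) \<open>open S\<close>]) (auto simp: S_def intro: hc)
      qed
      show "open ?C" using \<open>open S\<close> by (rule open_connected_component)
      show "Complex x\<^sub>0 t islimpt ?k"
      proof (rule connected_imp_perfect)
        have "Complex x\<^sub>0 t \<noteq> Complex x\<^sub>0 (3 * t)" using t by auto
        then show "?k \<noteq> {x}" for x by (metis ends_in_segment singletonD)
      qed auto
      show "G \<xi> z' - f (\<phi> 1 \<xi> + z') = 0" if "\<xi> \<in> ?k" for \<xi>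
        using G3[OF _ z'] that kK by auto
      show "\<xi>\<^sub>0 \<in> ?C" using \<open>?s \<subseteq> ?C\<close> by auto
    qed (use kC in auto)
    then show ?thesis by (simp add: h_def z'_def centre)
  qed
  have vert: "Re \<xi> = x\<^sub>0" "\<bar>Im \<xi>\<bar> < pi" "(Im \<xi>)\<^sup>2 \<le> 16" "- L \<le> Re \<xi>" "0 \<le> t * Im \<xi>"
    if "\<xi> \<in> closed_segment \<xi>\<^sub>0 (Complex x\<^sub>0 (3 * t))" "t = 1 \<or> t = -1" for \<xi> t
  proof -
    show Re: "Re \<xi> = x\<^sub>0" and *: "\<bar>Im \<xi>\<bar> < pi" and "0 \<le> t * Im \<xi>"
      using that pi3 by (auto simp: \<xi>\<^sub>0_def closed_segment_same_Re closed_segment_eq_real_ivl)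
    show "(Im \<xi>)\<^sup>2 \<le> 16" using * pi2 abs_le_square_iff[of "Im \<xi>" pi] by simp
    show "- L \<le> Re \<xi>" using Re x0' by simp
  qed
  \<comment> \<open>Along the path the point \<open>z\<close> is shifted by a vector whose imaginary
    part lies in the closed forward cone when the path goes down and in the backward one when it
    goes up; so \<open>z\<close> stays in its tube.\<close>
  have step: "\<phi> 1 \<xi> + (z - cpx (q - p)) = pt (u \<xi> + 1) (v 1 \<xi> - 1) + z" for \<xi> z
    using pt_diff[of "u \<xi>" "v 1 \<xi>" "- 1" 1] by (simp add: \<phi>_def centre(2))
  have tl: "(Im \<xi> < 0 \<longrightarrow> 0 < Im (u \<xi>) \<and> 0 < Im (v 1 \<xi>)) \<and> (0 < Im \<xi> \<longrightarrow> Im (u \<xi>) < 0 \<and> Im (v 1 \<xi>) < 0)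
      \<and> (Im \<xi> = 0 \<longrightarrow> Im (u \<xi>) = 0 \<and> Im (v 1 \<xi>) = 0)"
    if "\<xi> \<in> closed_segment \<xi>\<^sub>0 (Complex x\<^sub>0 (3 * t))" "t = 1 \<or> t = -1" for \<xi> t
  proof -
    note V = vert[OF that]
    have "3 * X\<^sup>2 * (2 * 1 - 1) < 3 * (Re \<xi>)\<^sup>2 - (Im \<xi>)\<^sup>2"
      by (rule far) (use V x0' in auto)
    note T = timelike[OF V(4) this _ V(2)]
    have "\<xi> = of_real x\<^sub>0" if "Im \<xi> = 0" using that V(1) by (simp add: complex_eq_iff)
    then show ?thesis using T by (auto simp: u_x0 v_x0)
  qed
  show ?thesis
  proof (rule that[of r h])
    show "0 < r" by fact
    have "holo_on (\<lambda>z. G \<xi>\<^sub>0 (z + - cpx (q - p))) (ball (cpx (q - p)) r)"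
      by (rule holo_on_subset[OF holo_on_translate[OF G1[OF \<xi>0]]])
         (auto simp: dist_norm norm_minus_commute)
    then show "holo_on h (ball (cpx (q - p)) r)" by (simp add: h_def[abs_def])
    fix z assume z: "z \<in> ball (cpx (q - p)) r" "z \<in> Tplus \<union> Tminus"
    show "h z = f z"
    proof (cases "z \<in> Tplus")
      case True
      show ?thesis
      proof (rule agree[OF z(1), of "-1"])
        fix \<xi> assume \<xi>: "\<xi> \<in> closed_segment \<xi>\<^sub>0 (Complex x\<^sub>0 (3 * -1))"
        have "pt (u \<xi> + 1) (v 1 \<xi> - 1) + z \<in> Tplus"
          by (rule pt_add_Tplus[OF True]) (use tl[OF \<xi>] vert(5)[OF \<xi>] in \<open>auto simp: le_less\<close>)
        then show "\<phi> 1 \<xi> + (z - cpx (q - p)) \<in> \<Omega>" by (simp add: step \<Omega>_def)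
      qed simp
    next
      case False
      then have zm: "z \<in> Tminus" using z by blast
      show ?thesis
      proof (rule agree[OF z(1), of "1"])
        fix \<xi> assume \<xi>: "\<xi> \<in> closed_segment \<xi>\<^sub>0 (Complex x\<^sub>0 (3 * 1))"
        have "pt (u \<xi> + 1) (v 1 \<xi> - 1) + z \<in> Tminus"
          by (rule pt_add_Tminus[OF zm]) (use tl[OF \<xi>] vert(5)[OF \<xi>] in \<open>auto simp: le_less\<close>)
        then show "\<phi> 1 \<xi> + (z - cpx (q - p)) \<in> \<Omega>" by (simp add: step \<Omega>_def)
      qed simp
    qed
  qed
qed

end

section \<open>Gluing the local extensions over the real points\<close>

definition re_pt :: "'m::finite cpt \<Rightarrow> 'm rpt" where
  "re_pt z = (Re (fst z), \<chi> i. Re (snd z $ i))"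

lemma norm_re_pt_le: "norm (re_pt z - x) \<le> norm (z - cpx x)"
proof -
  have "norm (\<chi> i. Re (snd z $ i) - (snd x $ i)) \<le> norm (snd z - (\<chi> i. complex_of_real (snd x $ i)))"
    unfolding norm_vec_def
    by (rule L2_set_mono) (auto simp: abs_Re_le_cmod[of "_ - complex_of_real _", simplified])
  moreover have "(\<chi> i. Re (snd z $ i) - (snd x $ i)) = snd (re_pt z - x)"
    by (simp add: re_pt_def vec_eq_iff)
  moreover have "norm (fst (re_pt z - x)) \<le> norm (fst z - complex_of_real (fst x))"
    using abs_Re_le_cmod[of "fst z - complex_of_real (fst x)"] by (simp add: re_pt_def)
  ultimately show ?thesis
    unfolding norm_prod_def by (intro real_sqrt_le_mono add_mono power_mono) (auto simp: cpx_def)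
qed

lemma Tplus_near_real:
  assumes "open S" "cpx x \<in> S"
  shows "S \<inter> Tplus \<noteq> {}"
proof -
  define t :: "'a rpt" where "t = (1, 0)"
  have t: "norm t = 1" by (simp add: t_def norm_prod_def)
  obtain e where e: "0 < e" "ball (cpx x) e \<subseteq> S" using assms openE by blast
  define z where "z = cscale (\<i> * of_real (e / 2)) (cpx t) + cpx x"
  have "z \<in> ball (cpx x) e"
    using e(1) t by (simp add: z_def dist_norm norm_cscale norm_mult)
  moreover have "im_pt (cpx x) = 0"
    using im_pt_cscale_cpx[of 1 x] by simp
  then have "im_pt z = (e / 2) *\<^sub>R t"
    by (simp add: z_def im_pt_add im_pt_cscale_cpx)
  then have "z \<in> Tplus" using e(1) by (simp add: Tplus_def Vplus_iff t_def)
  ultimately show ?thesis using e(2) by blast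
qed

text \<open>Taking real parts does not increase the distance to a real point, so two balls with real
  centres that meet share a real point. Their convex intersection therefore meets
  \<open>Tplus\<close>, and the identity theorem applies.\<close>

lemma real_balls_eq:
  assumes "holo_on f (ball (cpx x) r)" "holo_on g (ball (cpx y) s)"
    and eq: "\<And>z. z \<in> ball (cpx x) r \<inter> ball (cpx y) s \<Longrightarrow> z \<in> Tplus \<Longrightarrow> f z = g z"
    and z: "z \<in> ball (cpx x) r \<inter> ball (cpx y) s"
  shows "f z = g z"
proof -
  let ?A = "ball (cpx x) r \<inter> ball (cpx y) s"
  have "cpx (re_pt z) \<in> ?A"
  proof -
    have "dist (cpx a) (cpx (re_pt z)) \<le> dist (cpx a) z" for a
      using norm_re_pt_le[of z a] norm_minus_commute[of a "re_pt z"] norm_minus_commute[of "cpx a" z]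
      by (simp add: dist_norm flip: cpx_diff)
    then show ?thesis using z by (metis IntD1 IntD2 IntI le_less_trans mem_ball)
  qed
  then have ne: "?A \<inter> Tplus \<noteq> {}" by (intro Tplus_near_real) auto
  show ?thesis
  proof (rule holo_on_convex_eq[OF _ _ _ _ _ Int_lower1 ne _ z])
    show "holo_on f ?A" "holo_on g ?A"
      by (rule holo_on_subset[OF assms(1)] holo_on_subset[OF assms(2)]; blast)+
    show "f w = g w" if "w \<in> ?A \<inter> Tplus" for w
      using that eq by blast
  qed (simp_all add: open_Tplus open_Int convex_Int)
qed

lemma tilde_ball_union: "tilde B = (\<Union>x\<in>B. ball (cpx x) (infdist x (frontier B) / 32))"
  by (auto simp: tilde_def dist_norm norm_minus_commute)

text \<open>Agreement on the overlaps makes the choice by \<open>SOME\<close> immaterial: on each of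
  the open sets the glued function is \<open>f\<close> or one of the \<open>h x\<close>.\<close>

lemma holo_on_patch:
  assumes "open U" "holo_on f U"
    and V: "\<And>x. x \<in> I \<Longrightarrow> open (V x) \<and> holo_on (h x) (V x)"
    and hf: "\<And>x z. x \<in> I \<Longrightarrow> z \<in> V x \<inter> U \<Longrightarrow> h x z = f z"
    and hh: "\<And>x y z. x \<in> I \<Longrightarrow> y \<in> I \<Longrightarrow> z \<in> V x \<inter> V y \<Longrightarrow> h x z = h y z"
  obtains g where "holo_on g (U \<union> (\<Union>x\<in>I. V x))" "\<And>z. z \<in> U \<Longrightarrow> g z = f z"
proof -
  define g where "g z = (if z \<in> U then f z else h (SOME x. x \<in> I \<and> z \<in> V x) z)" for z
  have gh: "g z = h x z" if "x \<in> I" "z \<in> V x" for x z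
  proof -
    have "(SOME x. x \<in> I \<and> z \<in> V x) \<in> I \<and> z \<in> V (SOME x. x \<in> I \<and> z \<in> V x)"
      using that by (intro someI[of "\<lambda>x. x \<in> I \<and> z \<in> V x"] conjI)
    then have "h (SOME x. x \<in> I \<and> z \<in> V x) z = h x z"
      using hh that by blast
    then show ?thesis using hf[OF that(1)] that(2) unfolding g_def by simp
  qed
  have "holo_on g U"
    by (rule holo_on_cong[OF assms(1) _ assms(2)]) (simp add: g_def)
  moreover have "holo_on g (V x)" if "x \<in> I" for x
    using holo_on_cong[of "V x" "h x" g] V[OF that] gh[OF that] by auto
  ultimately have "holo_on g (U \<union> (\<Union>x\<in>I. V x))"
    unfolding holo_on_def by blast
  then show ?thesis by (rule that) (simp add: g_def)
qed

theorem theorem4p17: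
  fixes \<mu> :: real and s :: "'m::finite rpt"
  assumes "\<mu> \<ge> 0" and "s \<in> Vplus"
  shows "\<forall>f. holo_on f (tilde (Vmu \<mu>) \<union> tilde (ccompl (Dcone 0 s)) \<union> Tplus \<union> Tminus) \<longrightarrow>
           (\<exists>W g. open W \<and> cpx ` Rspace \<subseteq> W \<and>
              holo_on g (tilde (Vmu \<mu>) \<union> tilde (ccompl (Dcone 0 s)) \<union> Tplus \<union> Tminus \<union> W) \<and>
              (\<forall>z \<in> tilde (Vmu \<mu>) \<union> tilde (ccompl (Dcone 0 s)) \<union> Tplus \<union> Tminus. g z = f z))"
proof (intro allI impI)
  fix f :: "'m cpt \<Rightarrow> complex"
  let ?U = "tilde (Vmu \<mu>) \<union> tilde (ccompl (Dcone 0 s)) \<union> Tplus \<union> Tminus"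
  assume f: "holo_on f ?U"
  have U: "open ?U"
    by (auto simp: tilde_ball_union open_Tplus open_Tminus intro!: open_Un)
  have "\<exists>r h. 0 < r \<and> holo_on h (ball (cpx x) r) \<and> (\<forall>z\<in>ball (cpx x) r. z \<in> Tplus \<union> Tminus \<longrightarrow> h z = f z)"
    if x: "x \<in> Rspace" for x
  proof -
    obtain p q where pq: "norm (snd p) = fst p" "norm (snd q) = fst q" "0 < fst p" "0 < fst q"
      "0 < mink p q" and xpq: "x = q - p"
      using null_frame[OF x] .
    interpret null_pair p q by unfold_locales (fact pq)+
    show ?thesis
      using local_extension[OF assms(2) f U] unfolding xpq by metis
  qed
  then obtain r h where r: "\<And>x. x \<in> Rspace \<Longrightarrow> 0 < r x"
    and h: "\<And>x. x \<in> Rspace \<Longrightarrow> holo_on (h x) (ball (cpx x) (r x))"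
    and hT: "\<And>x z. x \<in> Rspace \<Longrightarrow> z \<in> ball (cpx x) (r x) \<Longrightarrow> z \<in> Tplus \<union> Tminus \<Longrightarrow> h x z = f z"
    by metis
  \<comment> \<open>Each \<open>tilde\<close> set is a union of balls with real centres, so
    agreement with \<open>f\<close> spreads from \<open>Tplus\<close> to the overlaps with
    it.\<close>
  have tilde_eq: "h x z = f z"
    if hyp: "x \<in> Rspace" "z \<in> ball (cpx x) (r x)" "z \<in> tilde B" "tilde B \<subseteq> ?U" for x z B
  proof -
    obtain y where y: "y \<in> B" "z \<in> ball (cpx y) (infdist y (frontier B) / 32)"
      using hyp(3) unfolding tilde_ball_union by blast
    have "holo_on f (ball (cpx y) (infdist y (frontier B) / 32))"
      by (rule holo_on_subset[OF f]) (use hyp(4) y(1) in \<open>auto simp: tilde_ball_union\<close>)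
    from real_balls_eq[OF h[OF hyp(1)] this] show ?thesis
      using hT hyp y by blast
  qed
  obtain g where g: "holo_on g (?U \<union> (\<Union>x\<in>Rspace. ball (cpx x) (r x)))" "\<And>z. z \<in> ?U \<Longrightarrow> g z = f z"
  proof (rule holo_on_patch[OF U f, where I = Rspace and V = "\<lambda>x. ball (cpx x) (r x)" and h = h])
    show "h x z = f z" if "x \<in> Rspace" "z \<in> ball (cpx x) (r x) \<inter> ?U" for x z
    proof -
      have "z \<in> tilde (Vmu \<mu>) \<or> z \<in> tilde (ccompl (Dcone 0 s)) \<or> z \<in> Tplus \<union> Tminus"
        using that(2) by blast
      then show ?thesis
        using that tilde_eq[OF that(1), of z "Vmu \<mu>"] tilde_eq[OF that(1), of z "ccompl (Dcone 0 s)"] hT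
        by blast
    qed
    show "h x z = h y z" if "x \<in> Rspace" "y \<in> Rspace" "z \<in> ball (cpx x) (r x) \<inter> ball (cpx y) (r y)" for x y z
      using real_balls_eq[OF h[OF that(1)] h[OF that(2)]] hT that by (metis IntD1 IntD2 UnI1)
  qed (use h in auto)
  show "\<exists>W g. open W \<and> cpx ` Rspace \<subseteq> W \<and> holo_on g (?U \<union> W) \<and> (\<forall>z\<in>?U. g z = f z)"
  proof (intro exI conjI)
    show "open (\<Union>x\<in>Rspace. ball (cpx x) (r x))" by auto
    show "cpx ` Rspace \<subseteq> (\<Union>x\<in>Rspace. ball (cpx x) (r x))" using r by auto
  qed (use g in auto)
qed

end
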